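(* Let $N\geq3$. The $N$-time mixed memoryless quantum processes form a strict subset of the $N$-time classical memory quantum processes, i.e. $\mathtt{MM}\subsetneq\mathtt{CM}$.
   Context: All Hilbert spaces are complex, nonzero and finite-dimensional; $\mathcal{L}(\mathcal{H})$ denotes the linear operators on $\mathcal{H}$; $\mathbb{1}_X$ is the identity operator on $\mathcal{H}_X$. Tensor factors are labelled, and operators are identified up to reordering of labelled factors. Choi operators. A linear map $\mathcal{K}:\mathcal{L}(\mathcal{H}_{a})\to\mathcal{L}(\mathcal{H}_{b})$ is represented by $\mathsf{K}=\sum_{ij}|i\rangle\langle j|\otimes\mathcal{K}(|i\rangle\langle j|)\in\mathcal{L}(\mathcal{H}_a\otimes\mathcal{H}_b)$ (computational basis). The map is a channel (CPTP) iff $\mathsf{K}\geq0$ and $\mathrm{tr}_b[\mathsf{K}]=\mathbb{1}_a$. The Choi operator of the trace map on $\mathcal{H}_a$ is $\mathbb{1}_a$. Link product. For $\mathsf{A}_{12}\in\mathcal{L}(\mathcal{H}_1\otimes\mathcal{H}_2)$ and $\mathsf{B}_{23}\in\mathcal{L}(\mathcal{H}_2\otimes\mathcal{H}_3)$, $\mathsf{A}_{12}\star\mathsf{B}_{23}:=\mathrm{tr}_2[(\mathsf{A}_{12}^{\mathrm{T}_2}\otimes\mathbb{1}_3)(\mathbb{1}_1\otimes\mathsf{B}_{23})]$, with $\mathrm{T}_2$ the partial transpose on $\mathcal{H}_2$ (contract over shared spaces, tensor product on the others). $\bigstar_j$ denotes an iterated link product. Spaces. At each time $t_j$, $j=1,\dots,N-1$,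 the system has two spaces $\mathcal{H}_{S_{j^{\mathtt{i}}}}$ and $\mathcal{H}_{S_{j^{\mathtt{o}}}}$; at $t_N$ it has only $\mathcal{H}_{S_{N^{\mathtt{i}}}}$. $N$-time processes are operators in $\mathcal{L}(\mathcal{H}_{S_{N^{\mathtt{i}}}}\otimes\bigotimes_{j=1}^{N-1}\mathcal{H}_{S_{j^{\mathtt{o}}}}\otimes\mathcal{H}_{S_{j^{\mathtt{i}}}})$. Below, $j^{\mathtt{i}}$, $j^{\mathtt{o}}$ without $S$ refer to the system spaces. The environment has arbitrary finite-dimensional spaces $\mathcal{H}_{E_{j^{\mathtt{i}}}}$, $\mathcal{H}_{E_{j^{\mathtt{o}}}}$ ($j\le N-1$) and $\mathcal{H}_{E_{N^{\mathtt{i}}}}$, not fixed in advance. Convention. For given $N$, each set below consists of all such operators, for all choices of finite-dimensional system spaces. Thus $A\subsetneq B$ means: $A\subseteq B$ for every choice of system spaces, and for some choice of system spaces there is an element of $B$ not in $A$. - $\mathtt{CM}$ (classical memory): operators of the form $$\mathbb{1}_{E_{N^{\mathtt{i}}}}\star\Big(\bigstar_{j=1}^{N-1}\mathsf{U}_{(ES)_{j+1^{\mathtt{i}}j^{\mathtt{o}}}}\star\mathsf{E}_{E_j}\Big)\star\rho_{(ES)_{1^{\mathtt{i}}}}$$ with $\rho_{(ES)_{1^{\mathtt{i}}}}$ a density operator on $\mathcal{H}_{E_{1^{\mathtt{i}}}}\otimes\mathcal{H}_{S_{1^{\mathtt{i}}}}$, each $\mathsf{U}_{(ES)_{j+1^{\mathtt{i}}j^{\mathtt{o}}}}$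 the Choi operator of a unitary channel $\mathcal{L}(\mathcal{H}_{E_{j^{\mathtt{o}}}}\otimes\mathcal{H}_{S_{j^{\mathtt{o}}}})\to\mathcal{L}(\mathcal{H}_{E_{j+1^{\mathtt{i}}}}\otimes\mathcal{H}_{S_{j+1^{\mathtt{i}}}})$, and each $\mathsf{E}_{E_j}=\sum_x\sigma^{(x)}_{E_{j^{\mathtt{o}}}}\otimes\mathsf{M}^{(x)}_{E_{j^{\mathtt{i}}}}$ an entanglement-breaking channel from $E_{j^{\mathtt{i}}}$ to $E_{j^{\mathtt{o}}}$ (finite sum; $\sigma^{(x)}$ density operators, $\{\mathsf{M}^{(x)}\}_x$ a POVM). - $\mathtt{MM}$ (mixed memoryless): operators $\sum_xp_x\,\mathsf{L}^{(x)}_{N^{\mathtt{i}}:N-1^{\mathtt{o}}}\otimes\dots\otimes\mathsf{L}^{(x)}_{2^{\mathtt{i}}:1^{\mathtt{o}}}\otimes\rho^{(x)}_{1^{\mathtt{i}}}$ (finite sum), with $p_x$ a probability distribution, each $\rho^{(x)}_{1^{\mathtt{i}}}$ a density operator on $\mathcal{H}_{S_{1^{\mathtt{i}}}}$, and each $\mathsf{L}^{(x)}_{j+1^{\mathtt{i}}:j^{\mathtt{o}}}\in\mathcal{L}(\mathcal{H}_{S_{j+1^{\mathtt{i}}}}\otimes\mathcal{H}_{S_{j^{\mathtt{o}}}})$ the Choi operator of a CPTP channel from $j^{\mathtt{o}}$ to $j+1^{\mathtt{i}}$. *)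

theory Defs
  imports Complex_Main "HOL-Library.FuncSet" "HOL-Library.Nonpos_Ints"
begin

section \<open>Operators on labelled tensor products\<close>

text \<open>
  A function \<open>d\<close> assigns to each label \<open>l\<close> the space with computational basis \<open>{..<d l}\<close>. The tensor
  product over a finite label set \<open>X\<close> has the basis \<open>multi d X\<close>. An operator on it is stored with
  its label set and its matrix entries, the entries being \<open>0\<close> at all other index pairs. Since
  basis elements are functions of the labels, reordering tensor factors changes nothing.
\<close>

type_synonym 'l index = "'l \<Rightarrow> nat"

record 'l lop =
  labels :: "'l set"
  entry :: "'l index \<Rightarrow> 'l index \<Rightarrow> complex"

definition multi :: "('l \<Rightarrow> nat) \<Rightarrow> 'l set \<Rightarrow> 'l index set" where
  "multi d X = (\<Pi>\<^sub>E l\<in>X. {..<d l})"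

definition mk_op :: "('l \<Rightarrow> nat) \<Rightarrow> 'l set \<Rightarrow> ('l index \<Rightarrow> 'l index \<Rightarrow> complex) \<Rightarrow> 'l lop" where
  "mk_op d X f =
     \<lparr>labels = X, entry = (\<lambda>i j. if i \<in> multi d X \<and> j \<in> multi d X then f i j else 0)\<rparr>"

definition ops :: "('l \<Rightarrow> nat) \<Rightarrow> 'l set \<Rightarrow> 'l lop set" where
  "ops d X = range (mk_op d X)"

definition id_op :: "('l \<Rightarrow> nat) \<Rightarrow> 'l set \<Rightarrow> 'l lop" where
  "id_op d X = mk_op d X (\<lambda>i j. of_bool (i = j))"

definition ketbra :: "('l \<Rightarrow> nat) \<Rightarrow> 'l set \<Rightarrow> 'l index \<Rightarrow> 'l index \<Rightarrow> 'l lop" where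
  "ketbra d X m n = mk_op d X (\<lambda>i j. of_bool (i = m \<and> j = n))"

definition op_scale :: "('l \<Rightarrow> nat) \<Rightarrow> complex \<Rightarrow> 'l lop \<Rightarrow> 'l lop" where
  "op_scale d c A = mk_op d (labels A) (\<lambda>i j. c * entry A i j)"

definition op_add :: "('l \<Rightarrow> nat) \<Rightarrow> 'l lop \<Rightarrow> 'l lop \<Rightarrow> 'l lop" where
  "op_add d A B = mk_op d (labels A) (\<lambda>i j. entry A i j + entry B i j)"

definition op_sum :: "('l \<Rightarrow> nat) \<Rightarrow> 'l set \<Rightarrow> ('x \<Rightarrow> 'l lop) \<Rightarrow> 'x set \<Rightarrow> 'l lop" where
  "op_sum d X F I = mk_op d X (\<lambda>i j. \<Sum>x\<in>I. entry (F x) i j)"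

definition op_mult :: "('l \<Rightarrow> nat) \<Rightarrow> 'l lop \<Rightarrow> 'l lop \<Rightarrow> 'l lop" where
  "op_mult d A B =
     mk_op d (labels A) (\<lambda>i j. \<Sum>k\<in>multi d (labels A). entry A i k * entry B k j)"

text \<open>Meaningful for disjoint label sets.\<close>

definition tensor :: "('l \<Rightarrow> nat) \<Rightarrow> 'l lop \<Rightarrow> 'l lop \<Rightarrow> 'l lop" where
  "tensor d A B = mk_op d (labels A \<union> labels B)
     (\<lambda>i j. entry A (restrict i (labels A)) (restrict j (labels A)) *
             entry B (restrict i (labels B)) (restrict j (labels B)))"

definition op_trace :: "('l \<Rightarrow> nat) \<Rightarrow> 'l lop \<Rightarrow> complex" where
  "op_trace d A = (\<Sum>i\<in>multi d (labels A). entry A i i)"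

text \<open>
  Partial trace and partial transpose on the factors in \<open>Z\<close>, where \<open>Z\<close> is a subset of the labels.
  Recall that \<open>override_on i k Z\<close> agrees with \<open>k\<close> on \<open>Z\<close> and with \<open>i\<close> elsewhere.
\<close>

definition ptrace :: "('l \<Rightarrow> nat) \<Rightarrow> 'l set \<Rightarrow> 'l lop \<Rightarrow> 'l lop" where
  "ptrace d Z A = mk_op d (labels A - Z)
     (\<lambda>i j. \<Sum>k\<in>multi d Z. entry A (override_on i k Z) (override_on j k Z))"

definition ptranspose :: "('l \<Rightarrow> nat) \<Rightarrow> 'l set \<Rightarrow> 'l lop \<Rightarrow> 'l lop" where
  "ptranspose d Z A = mk_op d (labels A)
     (\<lambda>i j. entry A (override_on i j Z) (override_on j i Z))"

definition psd :: "('l \<Rightarrow> nat) \<Rightarrow> 'l lop \<Rightarrow> bool" where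
  "psd d A \<longleftrightarrow> (\<forall>v :: 'l index \<Rightarrow> complex.
     (\<Sum>i\<in>multi d (labels A). \<Sum>j\<in>multi d (labels A). cnj (v i) * entry A i j * v j) \<in> \<real>\<^sub>\<ge>\<^sub>0)"

definition density :: "('l \<Rightarrow> nat) \<Rightarrow> 'l set \<Rightarrow> 'l lop \<Rightarrow> bool" where
  "density d X \<rho> \<longleftrightarrow> \<rho> \<in> ops d X \<and> psd d \<rho> \<and> op_trace d \<rho> = 1"

definition povm :: "('l \<Rightarrow> nat) \<Rightarrow> 'l set \<Rightarrow> nat \<Rightarrow> (nat \<Rightarrow> 'l lop) \<Rightarrow> bool" where
  "povm d X m M \<longleftrightarrow> (\<forall>x<m. M x \<in> ops d X \<and> psd d (M x)) \<and> op_sum d X M {..<m} = id_op d X"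


section \<open>Link product\<close>

definition link :: "('l \<Rightarrow> nat) \<Rightarrow> 'l lop \<Rightarrow> 'l lop \<Rightarrow> 'l lop" where
  "link d A B = ptrace d (labels A \<inter> labels B)
     (op_mult d
       (tensor d (ptranspose d (labels A \<inter> labels B) A) (id_op d (labels B - labels A)))
       (tensor d (id_op d (labels A - labels B)) B))"

text \<open>The iterated link product starts from the scalar \<open>1\<close>, the identity on no factors.\<close>

definition big_link :: "('l \<Rightarrow> nat) \<Rightarrow> (nat \<Rightarrow> 'l lop) \<Rightarrow> nat list \<Rightarrow> 'l lop" where
  "big_link d F js = foldr (link d) (map F js) (id_op d {})"


section \<open>Channels and Choi operators\<close>

definition linear_map ::
    "('l \<Rightarrow> nat) \<Rightarrow> 'l set \<Rightarrow> 'l set \<Rightarrow> ('l lop \<Rightarrow> 'l lop) \<Rightarrow> bool" where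
  "linear_map d a b K \<longleftrightarrow>
     (\<forall>A\<in>ops d a. K A \<in> ops d b) \<and>
     (\<forall>A\<in>ops d a. \<forall>B\<in>ops d a. K (op_add d A B) = op_add d (K A) (K B)) \<and>
     (\<forall>A\<in>ops d a. \<forall>c. K (op_scale d c A) = op_scale d c (K A))"

text \<open>
  An \<open>n \<times> n\<close> block matrix of operators is an operator on the tensor product with an \<open>n\<close>-dimensional
  ancilla; applying \<open>K\<close> to every block is the tensor product of \<open>K\<close> with the identity map of the
  ancilla.
\<close>

definition block_psd :: "('l \<Rightarrow> nat) \<Rightarrow> 'l set \<Rightarrow> nat \<Rightarrow> (nat \<Rightarrow> nat \<Rightarrow> 'l lop) \<Rightarrow> bool" where
  "block_psd d X n R \<longleftrightarrow> (\<forall>v :: nat \<Rightarrow> 'l index \<Rightarrow> complex.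
     (\<Sum>p<n. \<Sum>q<n. \<Sum>i\<in>multi d X. \<Sum>j\<in>multi d X. cnj (v p i) * entry (R p q) i j * v q j) \<in> \<real>\<^sub>\<ge>\<^sub>0)"

definition completely_positive ::
    "('l \<Rightarrow> nat) \<Rightarrow> 'l set \<Rightarrow> 'l set \<Rightarrow> ('l lop \<Rightarrow> 'l lop) \<Rightarrow> bool" where
  "completely_positive d a b K \<longleftrightarrow>
     (\<forall>n R. (\<forall>p<n. \<forall>q<n. R p q \<in> ops d a) \<longrightarrow> block_psd d a n R \<longrightarrow>
        block_psd d b n (\<lambda>p q. K (R p q)))"

definition trace_preserving ::
    "('l \<Rightarrow> nat) \<Rightarrow> 'l set \<Rightarrow> ('l lop \<Rightarrow> 'l lop) \<Rightarrow> bool" where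
  "trace_preserving d a K \<longleftrightarrow> (\<forall>A\<in>ops d a. op_trace d (K A) = op_trace d A)"

definition cptp :: "('l \<Rightarrow> nat) \<Rightarrow> 'l set \<Rightarrow> 'l set \<Rightarrow> ('l lop \<Rightarrow> 'l lop) \<Rightarrow> bool" where
  "cptp d a b K \<longleftrightarrow>
     linear_map d a b K \<and> completely_positive d a b K \<and> trace_preserving d a K"

definition choi :: "('l \<Rightarrow> nat) \<Rightarrow> 'l set \<Rightarrow> 'l set \<Rightarrow> ('l lop \<Rightarrow> 'l lop) \<Rightarrow> 'l lop" where
  "choi d a b K = op_sum d (a \<union> b)
     (\<lambda>(m, n). tensor d (ketbra d a m n) (K (ketbra d a m n))) (multi d a \<times> multi d a)"

text \<open>\<open>V i k\<close> is the matrix entry in row \<open>i\<close> (space \<open>b\<close>) and column \<open>k\<close> (space \<open>a\<close>).\<close>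

definition unitary ::
    "('l \<Rightarrow> nat) \<Rightarrow> 'l set \<Rightarrow> 'l set \<Rightarrow> ('l index \<Rightarrow> 'l index \<Rightarrow> complex) \<Rightarrow> bool" where
  "unitary d a b V \<longleftrightarrow>
     (\<forall>k\<in>multi d a. \<forall>l\<in>multi d a. (\<Sum>i\<in>multi d b. cnj (V i k) * V i l) = of_bool (k = l)) \<and>
     (\<forall>i\<in>multi d b. \<forall>j\<in>multi d b. (\<Sum>k\<in>multi d a. V i k * cnj (V j k)) = of_bool (i = j))"

definition unitary_map ::
    "('l \<Rightarrow> nat) \<Rightarrow> 'l set \<Rightarrow> 'l set \<Rightarrow> ('l index \<Rightarrow> 'l index \<Rightarrow> complex) \<Rightarrow> 'l lop \<Rightarrow> 'l lop" where
  "unitary_map d a b V A = mk_op d b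
     (\<lambda>i j. \<Sum>k\<in>multi d a. \<Sum>l\<in>multi d a. V i k * entry A k l * cnj (V j l))"


section \<open>Classical memory and mixed memoryless processes\<close>

datatype port = In nat | Out nat

datatype label = Sys port | Env port

fun joint_dim :: "(port \<Rightarrow> nat) \<Rightarrow> (port \<Rightarrow> nat) \<Rightarrow> label \<Rightarrow> nat" where
  "joint_dim s e (Sys p) = s p"
| "joint_dim s e (Env p) = e p"

text \<open>
  The argument \<open>s\<close> gives the dimensions of the system spaces at times \<open>1, \<dots>, N\<close>; its values at
  ports that do not occur are irrelevant. In \<open>CM\<close>, the dimensions \<open>e\<close> of the environment spaces are
  chosen along with the process.
\<close>

definition CM :: "nat \<Rightarrow> (port \<Rightarrow> nat) \<Rightarrow> label lop set" where
  "CM N s = {W. \<exists>e \<rho> V m \<sigma> M.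
     (\<forall>p. 0 < e p) \<and>
     (let d = joint_dim s e;
          ES_out = (\<lambda>j. {Env (Out j), Sys (Out j)});
          ES_in = (\<lambda>j. {Env (In j), Sys (In j)});
          U = (\<lambda>j. choi d (ES_out j) (ES_in (j + 1))
                 (unitary_map d (ES_out j) (ES_in (j + 1)) (V j)));
          EB = (\<lambda>j. op_sum d {Env (Out j), Env (In j)} (\<lambda>x. tensor d (\<sigma> j x) (M j x)) {..<m j})
      in density d (ES_in 1) \<rho> \<and>
         (\<forall>j\<in>{1..<N}.
            unitary d (ES_out j) (ES_in (j + 1)) (V j) \<and>
            (\<forall>x<m j. density d {Env (Out j)} (\<sigma> j x)) \<and>
            povm d {Env (In j)} (m j) (M j)) \<and>
         W = link d
               (link d (id_op d {Env (In N)}) (big_link d (\<lambda>j. link d (U j) (EB j)) [1..<N]))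
               \<rho>)}"

text \<open>
  Only system labels occur in the next definition; the dimension \<open>1\<close> for environment labels is a
  dummy.
\<close>

definition MM :: "nat \<Rightarrow> (port \<Rightarrow> nat) \<Rightarrow> label lop set" where
  "MM N s = {W. \<exists>(m :: nat) (p :: nat \<Rightarrow> real) K \<rho>.
     (let d = joint_dim s (\<lambda>_. 1);
          L = (\<lambda>x j. choi d {Sys (Out j)} {Sys (In (j + 1))} (K x j))
      in (\<forall>x<m. 0 \<le> p x) \<and> (\<Sum>x<m. p x) = 1 \<and>
         (\<forall>x<m. density d {Sys (In 1)} (\<rho> x) \<and>
            (\<forall>j\<in>{1..<N}. cptp d {Sys (Out j)} {Sys (In (j + 1))} (K x j))) \<and>
         W = op_sum d (Sys ` (In ` {1..N} \<union> Out ` {1..<N}))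
               (\<lambda>x. op_scale d (of_real (p x)) (fold (\<lambda>j. tensor d (L x j)) [1..<N] (\<rho> x)))
               {..<m})}"

end

theory Submission
  imports Defs
begin

text \<open>
  For the inclusion, the environment carries a classical register with the label \<open>x\<close> of the
  mixture: the entanglement-breaking channels measure \<open>x\<close> and prepare it again together with a
  fresh ancilla, and the unitaries are Stinespring dilations, controlled by \<open>x\<close>, of the given
  channels. The dilations come from a Cholesky decomposition of the Choi matrices (Kraus
  operators) and the completion of orthonormal systems to bases.

  For strictness, a bit that enters at the output of time 1 travels through the environment,
  where copying it classically does no harm, and leaves at the input of time 3. In a mixture of
  products of channels, the input of time 3 cannot depend on the output of time 1.
\<close>

section \<open>Entries of link products and Choi operators\<close>

text \<open>The dimensions shape the construction. Unitarity forces
  \<open>e (Out n) * s (Out n) = e (In (Suc n)) * s (In (Suc n))\<close> for arbitrary system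
  dimensions. A channel from \<open>Out n\<close> to the next input gets
  \<open>s (Out n) * s (In (Suc n))\<close> Kraus operators, and a register that holds one of
  \<open>m\<close> labels together with a Kraus index balances this equation if the prepared space
  has dimension \<open>m\<close> times the square of \<open>s (In (Suc n))\<close>. The ancilla is
  therefore no separate tensor factor: \<open>m\<close> basis states of the prepared space are
  distinguished, and only the columns of the unitary at these states are prescribed.

  The measurement reads the label but not the Kraus index. Summing over that index rebuilds the Choi
  matrix of the channel, while the label survives because it is only ever read in the basis in which
  it was written.

  For strictness, every space off the path of the bit has dimension 1. In particular
  \<open>In 2\<close> is trivial, so trace preservation leaves a channel from \<open>Out 1\<close>
  to \<open>In 2\<close> nothing to pass on. The bit has to enter the memory, be measured at time 2
  and leave again, so it reappears at time 3; hence the bound on \<open>N\<close>.\<close>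

text \<open>
  \<open>val\<close> reads matrix entries at indices that may carry further labels, so that tensor and link
  products become (sums of) pointwise products.
\<close>

definition val :: "'l lop \<Rightarrow> 'l index \<Rightarrow> 'l index \<Rightarrow> complex" where
  "val A i j = entry A (restrict i (labels A)) (restrict j (labels A))"

section \<open>Basis indices and the supports of operators\<close>

lemma restrict_multi_iff [simp]: "restrict i X \<in> multi d X \<longleftrightarrow> (\<forall>l\<in>X. i l < d l)"
  by (auto simp: multi_def)

lemma multi_lt: "i \<in> multi d X \<Longrightarrow> l \<in> X \<Longrightarrow> i l < d l"
  by (auto simp: multi_def)

lemma restrict_multi: "i \<in> multi d X \<Longrightarrow> restrict i X = i"
  by (auto simp: multi_def)

lemma finite_multi [simp]: "finite X \<Longrightarrow> finite (multi d X)"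
  by (auto simp: multi_def intro: finite_PiE)

lemma labels_simps [simp]:
  "labels (mk_op d X f) = X"
  "labels (tensor d A B) = labels A \<union> labels B"
  "labels (id_op d X) = X"
  "labels (op_sum d X F I) = X"
  "labels (op_scale d c A) = labels A"
  "labels (link d A B) = (labels A \<union> labels B) - (labels A \<inter> labels B)"
  "labels (choi d a b K) = a \<union> b"
  "labels (ketbra d a m n) = a"
  by (auto simp: mk_op_def tensor_def id_op_def op_sum_def op_scale_def link_def ptrace_def
      ptranspose_def op_mult_def choi_def ketbra_def)

lemma labels_ops: "A \<in> ops d X \<Longrightarrow> labels A = X"
  by (auto simp: ops_def)

lemma entry_mk_op:
  "entry (mk_op d X f) i j = (if i \<in> multi d X \<and> j \<in> multi d X then f i j else 0)"
  by (simp add: mk_op_def)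

lemma mk_op_ops [simp]: "mk_op d X f \<in> ops d X"
  by (simp add: ops_def)

lemma ops_entry0: "A \<in> ops d X \<Longrightarrow> i \<notin> multi d X \<or> j \<notin> multi d X \<Longrightarrow> entry A i j = 0"
  by (auto simp: ops_def entry_mk_op)

lemma ops_eqI:
  assumes "A \<in> ops d X" "B \<in> ops d X"
    and "\<And>i j. i \<in> multi d X \<Longrightarrow> j \<in> multi d X \<Longrightarrow> entry A i j = entry B i j"
  shows "A = B"
proof -
  have "entry A = entry B"
    using assms by (intro ext) (metis ops_entry0)
  moreover have "labels A = labels B"
    using assms(1,2) by (simp add: labels_ops)
  ultimately show ?thesis by simp
qed

lemma entry_val: "i \<in> multi d (labels A) \<Longrightarrow> j \<in> multi d (labels A) \<Longrightarrow> entry A i j = val A i j"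
  by (simp add: val_def restrict_multi)

lemma val_cong:
  assumes "\<And>l. l \<in> labels A \<Longrightarrow> i l = i' l" "\<And>l. l \<in> labels A \<Longrightarrow> j l = j' l"
  shows "val A i j = val A i' j'"
  using assms by (simp add: val_def cong: restrict_cong)

section \<open>Entries of sums, tensor products and identities\<close>

lemma val_mk_op:
  assumes "\<forall>l\<in>X. i l < d l" "\<forall>l\<in>X. j l < d l"
  shows "val (mk_op d X f) i j = f (restrict i X) (restrict j X)"
  using assms by (simp add: val_def entry_mk_op)

lemma val_tensor:
  assumes "\<forall>l\<in>labels A \<union> labels B. i l < d l" "\<forall>l\<in>labels A \<union> labels B. j l < d l"
  shows "val (tensor d A B) i j = val A i j * val B i j"
  unfolding tensor_def using assms
  by (subst val_mk_op) (simp_all add: val_def Int_absorb1 Int_absorb2)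

lemma val_op_sum:
  assumes "\<forall>l\<in>X. i l < d l" "\<forall>l\<in>X. j l < d l" "\<And>x. x \<in> I \<Longrightarrow> labels (F x) = X"
  shows "val (op_sum d X F I) i j = (\<Sum>x\<in>I. val (F x) i j)"
  unfolding op_sum_def using assms by (subst val_mk_op) (simp_all add: val_def)

lemma val_id_op:
  assumes "\<forall>l\<in>X. i l < d l" "\<forall>l\<in>X. j l < d l"
  shows "val (id_op d X) i j = of_bool (\<forall>l\<in>X. i l = j l)"
proof -
  have "restrict i X = restrict j X \<longleftrightarrow> (\<forall>l\<in>X. i l = j l)"
    by (metis restrict_apply' restrict_ext)
  then show ?thesis
    unfolding id_op_def using assms by (subst val_mk_op) simp_all
qed

text \<open>The partial transpose undoes the crossing of indices in the operator product: both
  factors are read at the same row \<open>w\<close> and the same column \<open>z\<close> on the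
  shared labels, and these are summed independently. No transposition is left in the result.\<close>

lemma val_link:
  fixes A B :: "'l lop"
  defines "Z \<equiv> labels A \<inter> labels B"
  assumes fin: "finite (labels A)" "finite (labels B)"
    and i: "\<forall>l\<in>labels A \<union> labels B - Z. i l < d l" and j: "\<forall>l\<in>labels A \<union> labels B - Z. j l < d l"
  shows "val (link d A B) i j = (\<Sum>w\<in>multi d Z. \<Sum>z\<in>multi d Z.
           val A (override_on i w Z) (override_on j z Z) * val B (override_on i w Z) (override_on j z Z))"
proof -
  define L where "L = labels A \<union> labels B"
  let ?T1 = "tensor d (ptranspose d Z A) (id_op d (labels B - labels A))"
  let ?T2 = "tensor d (id_op d (labels A - labels B)) B"
  have [simp]: "labels (ptranspose d Z A) = labels A"
    by (simp add: ptranspose_def)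
  have L1: "labels A \<union> (labels B - labels A) = L" "labels A - labels B \<union> labels B = L"
    by (auto simp: L_def)
  have finL: "finite L" "finite Z" using fin by (auto simp: L_def Z_def)
  have ZL: "Z \<subseteq> L" by (auto simp: Z_def L_def)
  have ij: "\<And>l. l \<in> L \<Longrightarrow> l \<notin> Z \<Longrightarrow> i l < d l" "\<And>l. l \<in> L \<Longrightarrow> l \<notin> Z \<Longrightarrow> j l < d l"
    using i j by (auto simp: L_def)
  have core: "(\<Sum>q\<in>multi d L. entry ?T1 (restrict (override_on i k Z) L) q * entry ?T2 q (restrict (override_on j k Z) L))
     = (\<Sum>w\<in>multi d Z. val A (override_on i w Z) (override_on j k Z) * val B (override_on i w Z) (override_on j k Z))"
    if k: "k \<in> multi d Z" for k
  proof -
    define ik where "ik = override_on i k Z"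
    define jk where "jk = override_on j k Z"
    have ikb: "\<forall>l\<in>L. ik l < d l" "\<forall>l\<in>L. jk l < d l"
      using ij k by (auto simp: ik_def jk_def override_on_def multi_lt)
    \<comment> \<open>The identity factors force the intermediate index \<open>q\<close> to agree
      with \<open>j\<close> on the labels of \<open>A\<close> alone and with \<open>i\<close> on the
      labels of \<open>B\<close> alone, so \<open>q\<close> is determined by its part
      \<open>w\<close> on \<open>Z\<close>.\<close>
    define h where "h w = restrict (\<lambda>l. if l \<in> Z then w l else if l \<in> labels A then j l else i l) L"
      for w :: "'l index"
    have e1: "entry ?T1 (restrict ik L) q = val A (override_on ik q Z) (override_on q ik Z)
                 * of_bool (\<forall>l\<in>labels B - labels A. ik l = q l)" 
      if q: "q \<in> multi d L" for q
    proof -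
      have "entry ?T1 (restrict ik L) q = val ?T1 ik q"
        using restrict_multi[OF q] by (simp add: val_def L_def)
      also have "\<dots> = val (ptranspose d Z A) ik q * val (id_op d (labels B - labels A)) ik q"
        using ikb q by (intro val_tensor) (auto simp: L1 L_def multi_lt)
      also have "val (id_op d (labels B - labels A)) ik q = of_bool (\<forall>l\<in>labels B - labels A. ik l = q l)"
        using ikb q by (intro val_id_op) (auto simp: L_def multi_lt)
      also have "val (ptranspose d Z A) ik q = val A (override_on ik q Z) (override_on q ik Z)"
        unfolding ptranspose_def using ikb q
        by (subst val_mk_op)
          (auto simp: L_def multi_lt val_def Z_def override_on_def intro!: arg_cong2[where f = "entry A"])
      finally show ?thesis .
    qed
    have e2: "entry ?T2 q (restrict jk L) = of_bool (\<forall>l\<in>labels A - labels B. q l = jk l) * val B q jk"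
      if q: "q \<in> multi d L" for q
    proof -
      have "entry ?T2 q (restrict jk L) = val ?T2 q jk"
        using restrict_multi[OF q] by (simp add: val_def L_def)
      also have "\<dots> = val (id_op d (labels A - labels B)) q jk * val B q jk"
        using ikb q by (intro val_tensor) (auto simp: L1 L_def multi_lt)
      also have "val (id_op d (labels A - labels B)) q jk = of_bool (\<forall>l\<in>labels A - labels B. q l = jk l)"
        using ikb q by (intro val_id_op) (auto simp: L_def multi_lt)
      finally show ?thesis .
    qed
    have "(\<Sum>q\<in>multi d L. entry ?T1 (restrict ik L) q * entry ?T2 q (restrict jk L)) =
      (\<Sum>q\<in>h ` multi d Z. entry ?T1 (restrict ik L) q * entry ?T2 q (restrict jk L))"
    proof (rule sum.mono_neutral_right)
      show "finite (multi d L)" using finL by simp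
      show "h ` multi d Z \<subseteq> multi d L"
        using ij by (auto simp: h_def multi_lt)
      show "\<forall>q\<in>multi d L - h ` multi d Z. entry ?T1 (restrict ik L) q * entry ?T2 q (restrict jk L) = 0"
      proof
        fix q assume q: "q \<in> multi d L - h ` multi d Z"
        show "entry ?T1 (restrict ik L) q * entry ?T2 q (restrict jk L) = 0"
        proof (rule ccontr)
          assume "\<not> ?thesis"
          then have *: "\<forall>l\<in>labels B - labels A. ik l = q l" "\<forall>l\<in>labels A - labels B. q l = jk l"
            using q by (auto simp: e1 e2)
          have "q = h (restrict q Z)"
          proof
            fix l show "q l = h (restrict q Z) l"
            proof (cases "l \<in> L")
              case False
              then show ?thesis using q by (auto simp: h_def multi_def PiE_def extensional_def)
            next
              case True
              then show ?thesis using * by (auto simp: h_def ik_def jk_def L_def Z_def override_on_def)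
            qed
          qed
          moreover have "restrict q Z \<in> multi d Z" using q ZL by (auto simp: multi_lt)
          ultimately show False using q by blast
        qed
      qed
    qed
    also have "\<dots> = (\<Sum>w\<in>multi d Z. entry ?T1 (restrict ik L) (h w) * entry ?T2 (h w) (restrict jk L))"
    proof (subst sum.reindex)
      show "inj_on h (multi d Z)"
      proof (rule inj_onI)
        fix w w' assume w: "w \<in> multi d Z" "w' \<in> multi d Z" and e: "h w = h w'"
        have "w l = w' l" if "l \<in> Z" for l
          using fun_cong[OF e, of l] that ZL by (auto simp: h_def)
        then show "w = w'" using w by (auto simp: multi_def intro: PiE_ext)
      qed
    qed simp
    also have "\<dots> = (\<Sum>w\<in>multi d Z. val A (override_on i w Z) jk * val B (override_on i w Z) jk)"
    proof (rule sum.cong[OF refl])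
      fix w assume w: "w \<in> multi d Z"
      have hw: "h w \<in> multi d L" using w ij by (auto simp: h_def multi_lt)
      have o: "\<forall>l\<in>labels B - labels A. ik l = h w l" "\<forall>l\<in>labels A - labels B. h w l = jk l"
        by (auto simp: h_def ik_def jk_def L_def Z_def override_on_def)
      have "val A (override_on ik (h w) Z) (override_on (h w) ik Z) = val A (override_on i w Z) jk"
        by (rule val_cong) (auto simp: h_def ik_def jk_def L_def Z_def override_on_def)
      moreover have "val B (h w) jk = val B (override_on i w Z) jk"
        by (rule val_cong) (auto simp: h_def ik_def jk_def L_def Z_def override_on_def)
      ultimately show "entry ?T1 (restrict ik L) (h w) * entry ?T2 (h w) (restrict jk L) =
          val A (override_on i w Z) jk * val B (override_on i w Z) jk"
        using o by (simp add: e1[OF hw] e2[OF hw])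
    qed
    finally show ?thesis by (simp add: ik_def jk_def)
  qed
  have "val (link d A B) i j = (\<Sum>k\<in>multi d Z. 
     entry (op_mult d ?T1 ?T2) (override_on (restrict i (L-Z)) k Z) (override_on (restrict j (L - Z)) k Z))"
    unfolding link_def ptrace_def Z_def[symmetric] using ij
    by (subst val_mk_op) (auto simp: op_mult_def L1 L_def)
  also have "\<dots> = (\<Sum>k\<in>multi d Z. \<Sum>w\<in>multi d Z.
       val A (override_on i w Z) (override_on j k Z) * val B (override_on i w Z) (override_on j k Z))"
  proof (rule sum.cong[OF refl])
    fix k assume k: "k \<in> multi d Z"
    have r: "override_on (restrict i (L-Z)) k Z = restrict (override_on i k Z) L"
      "override_on (restrict j (L-Z)) k Z = restrict (override_on j k Z) L"
      using ZL by (auto simp: override_on_def fun_eq_iff)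
    have "entry (op_mult d ?T1 ?T2) (restrict (override_on i k Z) L) (restrict (override_on j k Z) L)
       = (\<Sum>q\<in>multi d L. entry ?T1 (restrict (override_on i k Z) L) q * entry ?T2 q (restrict (override_on j k Z) L))"
      using ij k by (simp add: op_mult_def flip: L_def) (auto simp: entry_mk_op override_on_def multi_lt)
    then show "entry (op_mult d ?T1 ?T2) (override_on (restrict i (L-Z)) k Z) (override_on (restrict j (L - Z)) k Z)
      = (\<Sum>w\<in>multi d Z. val A (override_on i w Z) (override_on j k Z) * val B (override_on i w Z) (override_on j k Z))"
      unfolding r using core[OF k] by simp
  qed
  also have "\<dots> = (\<Sum>w\<in>multi d Z. \<Sum>k\<in>multi d Z.
       val A (override_on i w Z) (override_on j k Z) * val B (override_on i w Z) (override_on j k Z))"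
    by (rule sum.swap)
  finally show ?thesis .
qed

lemma sum_multi_singleton:
  "(\<Sum>w\<in>multi d {l}. g w) = (\<Sum>y<d l. g (restrict (\<lambda>_. y) {l}))"
proof (rule sum.reindex_bij_witness[of _ "\<lambda>y. restrict (\<lambda>_. y) {l}" "\<lambda>w. w l"])
  fix w assume "w \<in> multi d {l}"
  then show "restrict (\<lambda>_. w l) {l} = w"
    by (auto simp: multi_def PiE_def extensional_def fun_eq_iff)
  then show "g (restrict (\<lambda>_. w l) {l}) = g w" by simp
qed (auto simp: multi_lt)

lemma sum_multi_pair:
  assumes "l \<noteq> l'"
  shows "(\<Sum>w\<in>multi d {l, l'}. g (w l, w l')) = (\<Sum>p\<in>{..<d l} \<times> {..<d l'}. g p)"
  by (rule sum.reindex_bij_witness[of _ "\<lambda>p. restrict (\<lambda>k. if k = l then fst p else snd p) {l, l'}"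
        "\<lambda>w. (w l, w l')"])
    (use assms in \<open>auto simp: multi_def PiE_def extensional_def fun_eq_iff\<close>)

lemma val_link_single:
  assumes "labels A \<inter> labels B = {l}" "finite (labels A)" "finite (labels B)"
    and "\<forall>k\<in>labels A \<union> labels B - {l}. i k < d k" "\<forall>k\<in>labels A \<union> labels B - {l}. j k < d k"
  shows "val (link d A B) i j =
    (\<Sum>y<d l. \<Sum>z<d l. val A (i(l := y)) (j(l := z)) * val B (i(l := y)) (j(l := z)))"
proof -
  have "override_on f (restrict (\<lambda>_. y) {l}) {l} = f(l := y)" for f :: "'a \<Rightarrow> nat" and y
    by (auto simp: override_on_def)
  then show ?thesis
    using val_link[of A B i d j] assms by (simp add: sum_multi_singleton)
qed

lemma val_link_disjoint:
  assumes "labels A \<inter> labels B = {}" "finite (labels A)" "finite (labels B)"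
    and "\<forall>k\<in>labels A \<union> labels B. i k < d k" "\<forall>k\<in>labels A \<union> labels B. j k < d k"
  shows "val (link d A B) i j = val A i j * val B i j"
  using val_link[of A B i d j] assms by (simp add: multi_def)

lemma link_ops: "link d A B \<in> ops d (labels A \<union> labels B - labels A \<inter> labels B)"
proof -
  have "labels A \<union> (labels B - labels A) - labels A \<inter> labels B = labels A \<union> labels B - labels A \<inter> labels B"
    by auto
  then show ?thesis
    by (simp add: link_def ptrace_def op_mult_def ptranspose_def)
qed

lemma sum_of_bool_conj:
  assumes "finite M" "finite N" "a \<in> M" "b \<in> N"
  shows "(\<Sum>k\<in>M. \<Sum>l\<in>N. of_bool (k = a \<and> l = b) * g k l) = (g a b :: 'c::semiring_1)"
proof -
  have "(\<Sum>k\<in>M. \<Sum>l\<in>N. of_bool (k = a \<and> l = b) * g k l)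
      = (\<Sum>k\<in>M. if k = a then (\<Sum>l\<in>N. if l = b then g k l else 0) else 0)"
    by (auto intro!: sum.cong)
  then show ?thesis using assms by simp
qed

text \<open>The matrix units on \<open>a\<close> single out one summand, the block of the Choi
  matrix at the \<open>a\<close>-parts of \<open>i\<close> and \<open>j\<close>.\<close>

lemma val_choi:
  assumes "finite a" "finite b" 
    and K: "\<And>m n. m \<in> multi d a \<Longrightarrow> n \<in> multi d a \<Longrightarrow> labels (K (ketbra d a m n)) = b"
    and i: "\<forall>l\<in>a \<union> b. i l < d l" and j: "\<forall>l\<in>a \<union> b. j l < d l"
  shows "val (choi d a b K) i j = val (K (ketbra d a (restrict i a) (restrict j a))) i j"
proof -
  have t: "val (tensor d (ketbra d a m n) (K (ketbra d a m n))) i j 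
     = of_bool (m = restrict i a \<and> n = restrict j a) * val (K (ketbra d a m n)) i j"
    if "m \<in> multi d a" "n \<in> multi d a" for m n
  proof -
    have "val (ketbra d a m n) i j = of_bool (m = restrict i a \<and> n = restrict j a)"
      unfolding ketbra_def using i j by (subst val_mk_op) auto
    then show ?thesis
      using i j that by (subst val_tensor) (simp_all add: K)
  qed
  have "val (choi d a b K) i j
      = (\<Sum>(m, n)\<in>multi d a \<times> multi d a. val (tensor d (ketbra d a m n) (K (ketbra d a m n))) i j)"
    unfolding choi_def using i j by (subst val_op_sum) (auto simp: K split_beta)
  also have "\<dots> = (\<Sum>m\<in>multi d a. \<Sum>n\<in>multi d a.
       of_bool (m = restrict i a \<and> n = restrict j a) * val (K (ketbra d a m n)) i j)"
    by (simp add: sum.cartesian_product[symmetric] t)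
  also have "\<dots> = val (K (ketbra d a (restrict i a) (restrict j a))) i j"
    using assms by (intro sum_of_bool_conj) auto
  finally show ?thesis .
qed

text \<open>This Choi operator has rank one, being built from the vectorized matrix
  \<open>V\<close>, so every entry splits into a row factor and a conjugated column factor.\<close>

lemma val_choi_unitary_map:
  assumes "finite a" "finite b" "\<forall>l\<in>a \<union> b. i l < d l" "\<forall>l\<in>a \<union> b. j l < d l"
  shows "val (choi d a b (unitary_map d a b V)) i j =
    V (restrict i b) (restrict i a) * cnj (V (restrict j b) (restrict j a))"
proof -
  have "val (choi d a b (unitary_map d a b V)) i j =
    val (unitary_map d a b V (ketbra d a (restrict i a) (restrict j a))) i j"
    using assms by (intro val_choi) (auto simp: unitary_map_def)
  also have "\<dots> = (\<Sum>k\<in>multi d a. \<Sum>l\<in>multi d a. of_bool (k = restrict i a \<and> l = restrict j a) *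
       (V (restrict i b) k * cnj (V (restrict j b) l)))"
    unfolding unitary_map_def using assms
    by (subst val_mk_op) (simp_all add: ketbra_def entry_mk_op mult_ac cong: sum.cong)
  also have "\<dots> = V (restrict i b) (restrict i a) * cnj (V (restrict j b) (restrict j a))"
    using assms by (intro sum_of_bool_conj) auto
  finally show ?thesis .
qed

section \<open>Positive semidefinite matrices and orthonormal systems\<close>

text \<open>Cholesky decomposition: the induction step passes to the Schur complement.
  A zero pivot needs no separate case there, since division by \<open>0\<close> yields \<open>0\<close>.\<close>

lemma psd_gram:
  fixes A :: "'a \<Rightarrow> 'a \<Rightarrow> complex"
  assumes "finite X"
    and "\<And>v. (\<Sum>i\<in>X. \<Sum>j\<in>X. cnj (v i) * A i j * v j) \<in> \<real>\<^sub>\<ge>\<^sub>0"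
  shows "\<exists>B. \<forall>i\<in>X. \<forall>j\<in>X. A i j = (\<Sum>k\<in>X. B k i * cnj (B k j))"
  using assms
proof (induction X arbitrary: A rule: finite_induct)
  case empty
  then show ?case by simp
next
  case (insert a X)
  note fin = insert.hyps(1) and aX = insert.hyps(2)
  have split: "(\<Sum>i\<in>insert a X. \<Sum>j\<in>insert a X. cnj (v i) * A i j * v j) =
     cnj (v a) * A a a * v a + cnj (v a) * (\<Sum>j\<in>X. A a j * v j) + (\<Sum>i\<in>X. cnj (v i) * A i a) * v a
      + (\<Sum>i\<in>X. \<Sum>j\<in>X. cnj (v i) * A i j * v j)" for v
    using fin aX by (simp add: sum.distrib sum_distrib_left sum_distrib_right algebra_simps)
  have pos: "cnj (v a) * A a a * v a + cnj (v a) * (\<Sum>j\<in>X. A a j * v j) + (\<Sum>i\<in>X. cnj (v i) * A i a) * v a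
      + (\<Sum>i\<in>X. \<Sum>j\<in>X. cnj (v i) * A i j * v j) \<in> \<real>\<^sub>\<ge>\<^sub>0" for v
    using insert.prems[of v] unfolding split .
  \<comment> \<open>The test vectors have the entry \<open>t\<close> at \<open>a\<close> and 1 at
    \<open>b\<close>. Choices of \<open>t\<close> then give the reality of the diagonal,
    Hermiticity, and the vanishing of the column under a zero pivot.\<close>
  have two: "cnj t * A a a * t + cnj t * A a b + A b a * t + A b b \<in> \<real>\<^sub>\<ge>\<^sub>0" if b: "b \<in> X" for b t
  proof -
    define v where "v i = (if i = a then t else if i = b then 1 else 0)" for i
    have ab: "a \<noteq> b" using b aX by auto
    have va: "v a = t" by (simp add: v_def)
    have vX: "v i = (if i = b then 1 else 0)" if "i \<in> X" for i using that aX by (auto simp: v_def)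
    have 1: "(\<Sum>j\<in>X. A a j * v j) = A a b"
      using b fin by (simp add: vX if_distrib if_distribR cong: if_cong sum.cong)
    have 2: "(\<Sum>i\<in>X. cnj (v i) * A i a) = A b a"
    proof -
      have "(\<Sum>i\<in>X. cnj (v i) * A i a) = (\<Sum>i\<in>X. if i = b then A i a else 0)"
        by (intro sum.cong) (auto simp: vX)
      then show ?thesis using b fin by simp
    qed
    have 3: "(\<Sum>i\<in>X. \<Sum>j\<in>X. cnj (v i) * A i j * v j) = A b b"
    proof -
      have "(\<Sum>i\<in>X. \<Sum>j\<in>X. cnj (v i) * A i j * v j) = (\<Sum>i\<in>X. if i = b then (\<Sum>j\<in>X. if j = b then A i j else 0) else 0)"
        by (intro sum.cong) (auto simp: vX intro!: sum.cong)
      then show ?thesis using b fin by simp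
    qed
    show ?thesis using pos[of v] unfolding 1 2 3 va .
  qed
  have aa: "A a a \<in> \<real>\<^sub>\<ge>\<^sub>0"
  proof -
    have "(\<Sum>j\<in>X. A a j * (if j = a then 1 else 0)) = 0" 
      "(\<Sum>i\<in>X. cnj (if i = a then 1 else 0) * A i a) = 0"
      "(\<Sum>i\<in>X. \<Sum>j\<in>X. cnj (if i = a then 1 else 0) * A i j * (if j = a then 1 else 0)) = 0"
      using aX by (auto intro!: sum.neutral)
    then show ?thesis using pos[of "\<lambda>i. if i = a then 1 else 0"] by simp
  qed
  define c where "c = Re (A a a)"
  have Aaa: "A a a = of_real c" "0 \<le> c"
    using aa by (auto simp: c_def complex_nonneg_Reals_iff complex_eq_iff)
  have bb: "Im (A b b) = 0" if "b \<in> X" for b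
    using two[OF that, of 0] by (simp add: complex_nonneg_Reals_iff)
  have herm: "A a b = cnj (A b a)" if b: "b \<in> X" for b
    using two[OF b, of 1] two[OF b, of \<i>] bb[OF b]
    by (simp add: complex_nonneg_Reals_iff complex_eq_iff Aaa)
  have zero: "A b a = 0" if b: "b \<in> X" and c0: "c = 0" for b
  proof (rule ccontr)
    assume nz: "A b a \<noteq> 0"
    define n where "n = (cmod (A b a))\<^sup>2"
    have n: "n > 0" using nz by (simp add: n_def)
    \<comment> \<open>With this \<open>s\<close> the form takes a value with real part
      \<open>- Re (A b b) - 2\<close>, which is negative because \<open>Re (A b b)\<close> is
      nonnegative.\<close>
    define s where "s = (Re (A b b) + 1) / n"
    define t where "t = - (of_real s * cnj (A b a))"
    have 1: "A b a * cnj (A b a) = of_real n" by (simp add: n_def complex_norm_square[symmetric])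
    have "cnj t * A a a * t + cnj t * A a b + A b a * t + A b b
        = A b b - 2 * of_real s * (A b a * cnj (A b a))"
      using c0 by (simp add: Aaa herm[OF b] t_def algebra_simps)
    also have "\<dots> = A b b - of_real (2 * s * n)" by (simp add: 1)
    finally have e: "cnj t * A a a * t + cnj t * A a b + A b a * t + A b b = A b b - of_real (2 * s * n)" .
    have "0 \<le> Re (A b b) - 2 * s * n"
      using two[OF b, of t] unfolding e by (simp add: complex_nonneg_Reals_iff)
    moreover have "s * n = Re (A b b) + 1" using n by (simp add: s_def)
    moreover have "0 \<le> Re (A b b)" using two[OF b, of 0] by (simp add: complex_nonneg_Reals_iff)
    ultimately show False by linarith
  qed
  define A' where "A' i j = A i j - A i a * A a j / of_real c" for i j
  have "(\<Sum>i\<in>X. \<Sum>j\<in>X. cnj (v i) * A' i j * v j) \<in> \<real>\<^sub>\<ge>\<^sub>0" for v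
  proof -
    define p where "p = (\<Sum>i\<in>X. cnj (v i) * A i a)"
    define q where "q = (\<Sum>j\<in>X. A a j * v j)"
    \<comment> \<open>The component at \<open>a\<close> completes the square, and what is left is
      the form of the Schur complement \<open>A'\<close>. For \<open>c = 0\<close> the component is
      0 and \<open>A'\<close> is \<open>A\<close>.\<close>
    define v' where "v' = v(a := - q / of_real c)"
    have va: "v' a = - q / of_real c" by (simp add: v'_def)
    have vX: "v' i = v i" if "i \<in> X" for i using that aX by (auto simp: v'_def)
    have "(\<Sum>i\<in>X. \<Sum>j\<in>X. cnj (v i) * A' i j * v j) =
      (\<Sum>i\<in>X. \<Sum>j\<in>X. cnj (v i) * A i j * v j) - (\<Sum>i\<in>X. \<Sum>j\<in>X. (cnj (v i) * A i a) * (A a j * v j) / of_real c)"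
      unfolding A'_def by (simp add: sum_subtractf[symmetric] algebra_simps)
    also have "(\<Sum>i\<in>X. \<Sum>j\<in>X. (cnj (v i) * A i a) * (A a j * v j) / of_real c) = p * q / of_real c"
      unfolding p_def q_def by (simp add: sum_product sum_divide_distrib)
    finally have 1: "(\<Sum>i\<in>X. \<Sum>j\<in>X. cnj (v i) * A' i j * v j) =
      (\<Sum>i\<in>X. \<Sum>j\<in>X. cnj (v i) * A i j * v j) - p * q / of_real c" .
    have "cnj (v' a) * of_real c * v' a + cnj (v' a) * q + p * v' a
      + (\<Sum>i\<in>X. \<Sum>j\<in>X. cnj (v i) * A i j * v j) \<in> \<real>\<^sub>\<ge>\<^sub>0"
      using pos[of v'] unfolding p_def q_def by (simp add: vX Aaa cong: sum.cong)
    moreover have "cnj (v' a) * of_real c * v' a + cnj (v' a) * q + p * v' a = - (p * q / of_real c)"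
      unfolding va by (cases "c = 0") (auto simp: field_simps)
    ultimately show ?thesis unfolding 1 by (simp add: add.commute)
  qed
  from insert.IH[OF this] obtain B where B: "\<And>i j. i \<in> X \<Longrightarrow> j \<in> X \<Longrightarrow> A' i j = (\<Sum>k\<in>X. B k i * cnj (B k j))"
    by blast
  \<comment> \<open>Row \<open>a\<close> of the factor is column \<open>a\<close> of
    \<open>A\<close> divided by the root of the pivot. For \<open>c = 0\<close> this row is 0, in
    accordance with \<open>zero\<close>, which makes that column vanish.\<close>
  define B' where "B' k i = (if k = a then (if i = a then of_real (sqrt c) else A i a / of_real (sqrt c))
      else if i = a then 0 else B k i)" for k i
  have sq: "complex_of_real (sqrt c) * complex_of_real (sqrt c) = of_real c"
    using Aaa(2) by (simp flip: of_real_mult)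
  show ?case
  proof (intro exI[of _ B'] ballI)
    fix i j assume i: "i \<in> insert a X" and j: "j \<in> insert a X"
    have e: "(\<Sum>k\<in>insert a X. B' k i * cnj (B' k j)) = B' a i * cnj (B' a j) + 
       (\<Sum>k\<in>X. (if i = a then 0 else B k i) * cnj (if j = a then 0 else B k j))"
    proof -
      have "(\<Sum>k\<in>X. B' k i * cnj (B' k j)) =
         (\<Sum>k\<in>X. (if i = a then 0 else B k i) * cnj (if j = a then 0 else B k j))"
        using aX by (intro sum.cong) (auto simp: B'_def)
      then show ?thesis using aX fin by simp
    qed
    show "A i j = (\<Sum>k\<in>insert a X. B' k i * cnj (B' k j))"
    proof (cases "i = a"; cases "j = a")
      assume "i = a" "j = a"
      then show ?thesis unfolding e by (simp add: B'_def Aaa sq)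
    next
      assume *: "i = a" "j \<noteq> a"
      then show ?thesis using j zero[of j] unfolding e by (cases "c = 0") (auto simp: B'_def herm)
    next
      assume *: "i \<noteq> a" "j = a"
      then show ?thesis using i zero[of i] unfolding e by (cases "c = 0") (auto simp: B'_def)
    next
      assume *: "i \<noteq> a" "j \<noteq> a"
      then have ij: "i \<in> X" "j \<in> X" using i j by auto
      have "A i j = A i a * A a j / of_real c + A' i j" by (simp add: A'_def)
      then show ?thesis using * unfolding e by (simp add: B[OF ij] B'_def herm ij sq)
    qed
  qed
qed

section \<open>Orthonormal systems and their completion\<close>

definition orthonormal_on :: "'i set \<Rightarrow> 'k set \<Rightarrow> ('i \<Rightarrow> 'k \<Rightarrow> complex) \<Rightarrow> bool" where
  "orthonormal_on I S u \<longleftrightarrow> (\<forall>k\<in>S. \<forall>l\<in>S. (\<Sum>i\<in>I. cnj (u i k) * u i l) = of_bool (k = l))"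

text \<open>
  The trace of the projection \<open>P\<close> onto the orthogonal complement counts the missing vectors. If
  it is positive, some column of \<open>P\<close> extends the system. If it is \<open>0\<close>, then \<open>P = P\<^sup>* P\<close> vanishes.
\<close>

lemma residual_projection:
  fixes u :: "'i \<Rightarrow> 'k \<Rightarrow> complex"
  assumes fin: "finite I" "finite S" and u: "orthonormal_on I S u"
  defines "P \<equiv> \<lambda>i j. of_bool (i = j) - (\<Sum>k\<in>S. u i k * cnj (u j k))"
  shows "\<And>j l. j \<in> I \<Longrightarrow> l \<in> S \<Longrightarrow> (\<Sum>i\<in>I. cnj (u i l) * P i j) = 0"
    and "\<And>j. j \<in> I \<Longrightarrow> (\<Sum>i\<in>I. cnj (P i j) * P i j) = P j j"
    and "(\<Sum>i\<in>I. P i i) = of_nat (card I) - of_nat (card S)"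
proof -
  have un: "(\<Sum>i\<in>I. cnj (u i k) * u i l) = of_bool (k = l)" if "k \<in> S" "l \<in> S" for k l
    using u that by (auto simp: orthonormal_on_def)
  have orth: "(\<Sum>i\<in>I. cnj (u i l) * P i j) = 0" if l: "l \<in> S" and j: "j \<in> I" for l j
  proof -
    have "(\<Sum>i\<in>I. cnj (u i l) * P i j) = (\<Sum>i\<in>I. if i = j then cnj (u i l) else 0)
        - (\<Sum>i\<in>I. \<Sum>k\<in>S. cnj (u i l) * u i k * cnj (u j k))"
      unfolding P_def sum_subtractf[symmetric]
      by (intro sum.cong) (auto simp: sum_distrib_left algebra_simps)
    also have "(\<Sum>i\<in>I. \<Sum>k\<in>S. cnj (u i l) * u i k * cnj (u j k))
        = (\<Sum>k\<in>S. (\<Sum>i\<in>I. cnj (u i l) * u i k) * cnj (u j k))"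
      by (subst sum.swap) (simp add: sum_distrib_right)
    also have "\<dots> = (\<Sum>k\<in>S. if k = l then cnj (u j k) else 0)"
      using l by (intro sum.cong) (auto simp: un)
    finally show ?thesis using fin l j by simp
  qed
  show "(\<Sum>i\<in>I. cnj (u i l) * P i j) = 0" if "j \<in> I" "l \<in> S" for j l
    using orth that by blast
  show "(\<Sum>i\<in>I. cnj (P i j) * P i j) = P j j" if j: "j \<in> I" for j
  proof -
    have cP: "cnj (P i j) = of_bool (i = j) - (\<Sum>k\<in>S. u j k * cnj (u i k))" for i
      by (simp add: P_def mult.commute)
    have "(\<Sum>i\<in>I. cnj (P i j) * P i j) = (\<Sum>i\<in>I. if i = j then P i j else 0)
        - (\<Sum>i\<in>I. \<Sum>k\<in>S. u j k * (cnj (u i k) * P i j))"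
      unfolding sum_subtractf[symmetric] cP
      by (intro sum.cong) (auto simp: sum_distrib_right left_diff_distrib mult.assoc)
    also have "(\<Sum>i\<in>I. \<Sum>k\<in>S. u j k * (cnj (u i k) * P i j)) = (\<Sum>k\<in>S. u j k * (\<Sum>i\<in>I. cnj (u i k) * P i j))"
      by (subst sum.swap) (simp add: sum_distrib_left)
    also have "\<dots> = 0" using orth j by simp
    finally show ?thesis using fin j by simp
  qed
  have "(\<Sum>i\<in>I. P i i) = of_nat (card I) - (\<Sum>k\<in>S. \<Sum>i\<in>I. cnj (u i k) * u i k)"
    unfolding P_def sum_subtractf by (subst sum.swap) (simp add: mult.commute)
  also have "(\<Sum>k\<in>S. \<Sum>i\<in>I. cnj (u i k) * u i k) = of_nat (card S)"
    by (simp add: un)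
  finally show "(\<Sum>i\<in>I. P i i) = of_nat (card I) - of_nat (card S)" .
qed

lemma orthonormal_extend_one:
  fixes u :: "'i \<Rightarrow> 'k \<Rightarrow> complex"
  assumes fin: "finite I" "finite S" and u: "orthonormal_on I S u" and less: "card S < card I" and a: "a \<notin> S"
  shows "\<exists>w. orthonormal_on I (insert a S) (\<lambda>i. (u i)(a := w i))"
proof -
  define P where "P i j = of_bool (i = j) - (\<Sum>k\<in>S. u i k * cnj (u j k))" for i j
  note R = residual_projection[OF fin u, folded P_def]
  have "(\<Sum>i\<in>I. P i i) \<noteq> 0" using less unfolding R(3) by simp
  then obtain j where j: "j \<in> I" "P j j \<noteq> 0" by (meson sum.neutral)
  \<comment> \<open>A diagonal entry of the projection is the squared norm of its column, so a
    nonzero one allows the column to be normalised.\<close>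
  have pj: "P j j = of_real (\<Sum>i\<in>I. (cmod (P i j))\<^sup>2)"
    by (subst R(2)[OF j(1), symmetric]) (simp only: of_real_sum complex_norm_square mult.commute)
  define c where "c = (\<Sum>i\<in>I. (cmod (P i j))\<^sup>2)"
  have c: "c > 0" using j pj sum_nonneg[of I "\<lambda>i. (cmod (P i j))\<^sup>2"] 
    by (auto simp: c_def[symmetric] less_le)
  define w where "w i = P i j / of_real (sqrt c)" for i
  have sq: "complex_of_real (sqrt c) * complex_of_real (sqrt c) = of_real c"
    using c by (simp flip: of_real_mult)
  have ww: "(\<Sum>i\<in>I. cnj (w i) * w i) = 1"
  proof -
    have "(\<Sum>i\<in>I. cnj (w i) * w i) = (\<Sum>i\<in>I. cnj (P i j) * P i j) / of_real c"
      by (simp add: w_def sum_divide_distrib sq)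
    then show ?thesis using R(2)[OF j(1)] pj c by (simp add: c_def[symmetric])
  qed
  have uw: "(\<Sum>i\<in>I. cnj (u i l) * w i) = 0" if "l \<in> S" for l
    using R(1)[OF j(1) that] by (simp add: w_def sum_divide_distrib[symmetric])
  have wu: "(\<Sum>i\<in>I. cnj (w i) * u i l) = 0" if "l \<in> S" for l
    using arg_cong[OF uw[OF that], of cnj] by (simp add: mult.commute)
  have un: "(\<Sum>i\<in>I. cnj (u i k) * u i l) = of_bool (k = l)" if "k \<in> S" "l \<in> S" for k l
    using u that by (auto simp: orthonormal_on_def)
  have "(\<Sum>i\<in>I. cnj (((u i)(a := w i)) k) * ((u i)(a := w i)) l) = of_bool (k = l)"
    if "k \<in> insert a S" "l \<in> insert a S" for k l
    using that a by (cases "k = a"; cases "l = a") (simp_all add: ww uw wu un)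
  then show ?thesis unfolding orthonormal_on_def by blast
qed

text \<open>Turns an isometry into a unitary: the columns in \<open>S\<close> are kept, those in
  \<open>J - S\<close> are added one at a time, and \<open>card J \<le> card I\<close> leaves room
  for each.\<close>

lemma orthonormal_extend:
  fixes u :: "'i \<Rightarrow> 'k \<Rightarrow> complex"
  assumes fin: "finite I" "finite J" and SJ: "S \<subseteq> J" and card: "card J \<le> card I" and u: "orthonormal_on I S u"
  shows "\<exists>u'. orthonormal_on I J u' \<and> (\<forall>i. \<forall>k\<in>S. u' i k = u i k)"
proof -
  have "\<exists>u'. orthonormal_on I (S \<union> D) u' \<and> (\<forall>i. \<forall>k\<in>S. u' i k = u i k)" if "finite D" "D \<subseteq> J - S" for D
    using that
  proof (induction D rule: finite_induct)
    case empty
    then show ?case using u by auto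
  next
    case (insert a D)
    then obtain u' where u': "orthonormal_on I (S \<union> D) u'" "\<forall>i. \<forall>k\<in>S. u' i k = u i k" by auto
    have aS: "a \<notin> S \<union> D" "a \<in> J" using insert by auto
    then have "S \<union> D \<subset> J" using SJ insert by auto
    then have less: "card (S \<union> D) < card I"
      using psubset_card_mono[OF fin(2), of "S \<union> D"] card by linarith
    have "finite (S \<union> D)" using fin(2) SJ insert.hyps(1) by (meson finite_UnI finite_subset)
    from orthonormal_extend_one[OF fin(1) this u'(1) less aS(1)]
    obtain w where "orthonormal_on I (insert a (S \<union> D)) (\<lambda>i. (u' i)(a := w i))" by blast
    moreover have "\<forall>i. \<forall>k\<in>S. ((u' i)(a := w i)) k = u i k" using u'(2) aS by auto
    ultimately show ?case unfolding Un_insert_right by blast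
  qed
  from this[of "J - S"] show ?thesis using fin SJ by (simp add: Un_absorb1)
qed

text \<open>Supplies the second equation of \<open>unitary\<close> from the first: in the square
  case the squared moduli of all entries of the residual projection add up to its trace, which is
  0.\<close>

lemma orthonormal_complete:
  fixes u :: "'i \<Rightarrow> 'k \<Rightarrow> complex"
  assumes fin: "finite I" "finite J" and card: "card J = card I" and u: "orthonormal_on I J u"
    and ij: "i \<in> I" "j \<in> I"
  shows "(\<Sum>k\<in>J. u i k * cnj (u j k)) = of_bool (i = j)"
proof -
  define P where "P i j = of_bool (i = j) - (\<Sum>k\<in>J. u i k * cnj (u j k))" for i j
  note R = residual_projection[OF fin u, folded P_def]
  have pj: "P j j = of_real (\<Sum>i\<in>I. (cmod (P i j))\<^sup>2)" if "j \<in> I" for j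
    by (subst R(2)[OF that, symmetric]) (simp only: of_real_sum complex_norm_square mult.commute)
  have "(\<Sum>j\<in>I. P j j) = of_real (\<Sum>j\<in>I. \<Sum>i\<in>I. (cmod (P i j))\<^sup>2)"
    by (simp add: pj)
  also have "(\<Sum>j\<in>I. P j j) = of_real 0"
    using R(3) card by simp
  finally have "(\<Sum>j\<in>I. \<Sum>i\<in>I. (cmod (P i j))\<^sup>2) = 0"
    unfolding of_real_eq_iff by simp
  then have "P i j = 0"
    using ij fin by (simp add: sum_nonneg sum_nonneg_eq_0_iff)
  then show ?thesis by (simp add: P_def)
qed

section \<open>Classical memory with a readout register\<close>

lemma cnj_mult_self_nonneg: "cnj z * z \<in> \<real>\<^sub>\<ge>\<^sub>0"
  by (simp add: complex_nonneg_Reals_iff)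

lemma sum_nonneg_Reals:
  fixes g :: "'a \<Rightarrow> complex"
  shows "(\<And>x. x \<in> X \<Longrightarrow> g x \<in> \<real>\<^sub>\<ge>\<^sub>0) \<Longrightarrow> sum g X \<in> \<real>\<^sub>\<ge>\<^sub>0"
  by (induction X rule: infinite_finite_induct) auto

lemma upd_Env_o_Sys [simp]: "(i(Env p := y)) \<circ> Sys = i \<circ> Sys"
  by auto

lemma density_ketbra:
  assumes "x < d l"
  shows "density d {l} (mk_op d {l} (\<lambda>i j. of_bool (i l = x \<and> j l = x)))"
proof -
  have s: "(\<Sum>y<d l. \<Sum>z<d l. of_bool (y = x \<and> z = x) * (cnj (v y) * v z)) = cnj (v x) * v x"
    for v :: "nat \<Rightarrow> complex"
    using assms by (intro sum_of_bool_conj) auto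
  have "psd d (mk_op d {l} (\<lambda>i j. of_bool (i l = x \<and> j l = x)))"
    unfolding psd_def
  proof
    fix v :: "('a \<Rightarrow> nat) \<Rightarrow> complex"
    have "(\<Sum>i\<in>multi d {l}. \<Sum>j\<in>multi d {l}. cnj (v i) *
        entry (mk_op d {l} (\<lambda>i j. of_bool (i l = x \<and> j l = x))) i j * v j) =
        (\<Sum>y<d l. \<Sum>z<d l. of_bool (y = x \<and> z = x) *
         (cnj (v (restrict (\<lambda>_. y) {l})) * v (restrict (\<lambda>_. z) {l})))"
      by (simp add: sum_multi_singleton entry_mk_op mult_ac)
    then show "(\<Sum>i\<in>multi d (labels (mk_op d {l} (\<lambda>i j. of_bool (i l = x \<and> j l = x)))).
       \<Sum>j\<in>multi d (labels (mk_op d {l} (\<lambda>i j. of_bool (i l = x \<and> j l = x)))). cnj (v i) *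
        entry (mk_op d {l} (\<lambda>i j. of_bool (i l = x \<and> j l = x))) i j * v j) \<in> \<real>\<^sub>\<ge>\<^sub>0"
      unfolding s using cnj_mult_self_nonneg by simp
  qed
  moreover have "op_trace d (mk_op d {l} (\<lambda>i j. of_bool (i l = x \<and> j l = x))) = 1"
    using assms by (simp add: op_trace_def sum_multi_singleton entry_mk_op of_bool_def)
  ultimately show ?thesis by (simp add: density_def)
qed

text \<open>The effects project onto the level sets of \<open>r\<close>, so the readout may be
  coarse: in the inclusion \<open>r\<close> forgets the Kraus index, in the witness it is the
  identity.\<close>

lemma povm_readout:
  assumes "\<And>y. y < d l \<Longrightarrow> r y < m" and "finite X" "l \<in> X"
  shows "povm d X m (\<lambda>x. mk_op d X (\<lambda>i j. of_bool (i = j \<and> r (i l) = x)))"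
  unfolding povm_def
proof (intro conjI allI impI)
  fix x
  show "psd d (mk_op d X (\<lambda>i j. of_bool (i = j \<and> r (i l) = x)))"
    unfolding psd_def
  proof
    fix v :: "('a \<Rightarrow> nat) \<Rightarrow> complex"
    have "(\<Sum>i\<in>multi d X. \<Sum>j\<in>multi d X. cnj (v i) *
        entry (mk_op d X (\<lambda>i j. of_bool (i = j \<and> r (i l) = x))) i j * v j) =
      (\<Sum>i\<in>multi d X. \<Sum>j\<in>multi d X. if i = j then of_bool (r (i l) = x) * (cnj (v i) * v i) else 0)"
      by (intro sum.cong) (auto simp: entry_mk_op)
    also have "\<dots> = (\<Sum>i\<in>multi d X. of_bool (r (i l) = x) * (cnj (v i) * v i))"
      using assms by simp
    also have "\<dots> \<in> \<real>\<^sub>\<ge>\<^sub>0"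
      by (intro sum_nonneg_Reals nonneg_Reals_mult_I cnj_mult_self_nonneg) auto
    finally show "(\<Sum>i\<in>multi d (labels (mk_op d X (\<lambda>i j. of_bool (i = j \<and> r (i l) = x)))).
       \<Sum>j\<in>multi d (labels (mk_op d X (\<lambda>i j. of_bool (i = j \<and> r (i l) = x)))). cnj (v i) *
        entry (mk_op d X (\<lambda>i j. of_bool (i = j \<and> r (i l) = x))) i j * v j) \<in> \<real>\<^sub>\<ge>\<^sub>0"
      by simp
  qed
next
  have "(\<Sum>x<m. of_bool (i = j \<and> r (i l) = x)) = (of_bool (i = j) :: complex)"
    if "i \<in> multi d X" for i j
  proof -
    have "r (i l) < m" using that assms by (auto simp: multi_lt)
    then show ?thesis by (cases "i = j") (simp_all add: of_bool_def)
  qed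
  then show "op_sum d X (\<lambda>x. mk_op d X (\<lambda>i j. of_bool (i = j \<and> r (i l) = x))) {..<m} = id_op d X"
    unfolding op_sum_def id_op_def by (intro ops_eqI[of _ d X]) (auto simp: entry_mk_op)
qed simp

text \<open>
  The memory processes that both halves of the theorem use. The measurement at time \<open>n\<close> reads
  \<open>r n y\<close> off the environment basis state \<open>y\<close> and prepares the basis state \<open>r n y\<close>. Then only
  diagonal environment terms survive, and the contribution \<open>f n y\<close> of the times after \<open>n\<close>, given
  the basis state \<open>y\<close> at time \<open>n\<close>, satisfies a backward recursion.
\<close>

lemma CM_readoutI:
  fixes u :: "nat \<Rightarrow> nat \<times> nat \<Rightarrow> nat \<times> nat \<Rightarrow> complex"
    and f :: "nat \<Rightarrow> nat \<Rightarrow> (port \<Rightarrow> nat) \<Rightarrow> (port \<Rightarrow> nat) \<Rightarrow> complex"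
  defines "X N \<equiv> Sys ` (In ` {1..N} \<union> Out ` {1..<N})"
  assumes N: "2 \<le> N" and pos: "\<And>p. 0 < e p"
    and r: "\<And>n y. n \<in> {1..<N} \<Longrightarrow> y < e (In n) \<Longrightarrow> r n y < m n"
    and m: "\<And>n. n \<in> {1..<N} \<Longrightarrow> m n \<le> e (Out n)"
    and dims: "\<And>n. n \<in> {1..<N} \<Longrightarrow> e (Out n) * s (Out n) = e (In (Suc n)) * s (In (Suc n))"
    and u: "\<And>n. n \<in> {1..<N} \<Longrightarrow> orthonormal_on ({..<e (In (Suc n))} \<times> {..<s (In (Suc n))})
              ({..<e (Out n)} \<times> {..<s (Out n)}) (u n)"
    and fN: "\<And>y a b. f N y a b = 1"
    and f: "\<And>n y a b. n \<in> {1..<N} \<Longrightarrow> y < e (In n) \<Longrightarrow>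
       a (Out n) < s (Out n) \<Longrightarrow> b (Out n) < s (Out n) \<Longrightarrow>
       a (In (Suc n)) < s (In (Suc n)) \<Longrightarrow> b (In (Suc n)) < s (In (Suc n)) \<Longrightarrow>
       f n y a b = (\<Sum>y'<e (In (Suc n)). u n (y', a (In (Suc n))) (r n y, a (Out n)) *
         cnj (u n (y', b (In (Suc n))) (r n y, b (Out n))) * f (Suc n) y' a b)"
    and \<rho>: "density (joint_dim s e) {Env (In 1), Sys (In 1)} \<rho>"
    and W: "W \<in> ops (joint_dim s e) (X N)"
    and entry_W: "\<And>i j. i \<in> multi (joint_dim s e) (X N) \<Longrightarrow> j \<in> multi (joint_dim s e) (X N) \<Longrightarrow>
       entry W i j = (\<Sum>y<e (In 1). f 1 y (i \<circ> Sys) (j \<circ> Sys) *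
          val \<rho> (i(Env (In 1) := y)) (j(Env (In 1) := y)))"
  shows "W \<in> CM N s"
proof -
  define d where "d = joint_dim s e"
  have [simp]: "d (Sys p) = s p" "d (Env p) = e p" for p by (simp_all add: d_def)
  define V where "V n i k = u n (i (Env (In (Suc n))), i (Sys (In (Suc n)))) (k (Env (Out n)), k (Sys (Out n)))"
    for n and i k :: "label index"
  define \<sigma> where "\<sigma> n x = mk_op d {Env (Out n)} (\<lambda>i j. of_bool (i (Env (Out n)) = x \<and> j (Env (Out n)) = x))"
    for n x
  define M where "M n x = mk_op d {Env (In n)} (\<lambda>i j. of_bool (i = j \<and> r n (i (Env (In n))) = x))"
    for n x
  define U where "U n = choi d {Env (Out n), Sys (Out n)} {Env (In (n + 1)), Sys (In (n + 1))}
       (unitary_map d {Env (Out n), Sys (Out n)} {Env (In (n + 1)), Sys (In (n + 1))} (V n))" for n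
  define EB where "EB n = op_sum d {Env (Out n), Env (In n)} (\<lambda>x. tensor d (\<sigma> n x) (M n x)) {..<m n}" for n
  define G where "G n = link d (U n) (EB n)" for n
  define H where "H n = big_link d G [n..<N]" for n

  \<comment> \<open>Entries of one step: measurement, preparation, unitary\<close>
  have labG: "labels (G n) = {Sys (Out n), Env (In n), Env (In (Suc n)), Sys (In (Suc n))}" for n
    by (auto simp: G_def U_def EB_def)
  have val_EB: "val (EB n) i j = of_bool (i (Env (In n)) = j (Env (In n))) *
      of_bool (i (Env (Out n)) = r n (i (Env (In n))) \<and> j (Env (Out n)) = r n (i (Env (In n))))"
    if n: "n \<in> {1..<N}"
      and i: "i (Env (Out n)) < e (Out n)" "i (Env (In n)) < e (In n)"
      and j: "j (Env (Out n)) < e (Out n)" "j (Env (In n)) < e (In n)" for n i j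
  proof -
    let ?x = "r n (i (Env (In n)))"
    have eq: "restrict i {l} = restrict j {l} \<longleftrightarrow> i l = j l" for l
      by (auto simp: fun_eq_iff restrict_def)
    have "val (EB n) i j = (\<Sum>x<m n. val (tensor d (\<sigma> n x) (M n x)) i j)"
      unfolding EB_def using i j by (subst val_op_sum) (auto simp: \<sigma>_def M_def)
    also have "\<dots> = (\<Sum>x<m n. val (\<sigma> n x) i j * val (M n x) i j)"
      using i j by (intro sum.cong val_tensor) (auto simp: \<sigma>_def M_def)
    also have "\<dots> = (\<Sum>x<m n. of_bool (i (Env (Out n)) = x \<and> j (Env (Out n)) = x) *
        of_bool (i (Env (In n)) = j (Env (In n)) \<and> ?x = x))"
      unfolding \<sigma>_def M_def using i j by (simp add: val_mk_op eq)
    also have "\<dots> = (\<Sum>x<m n. if ?x = x then of_bool (i (Env (In n)) = j (Env (In n))) *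
        of_bool (i (Env (Out n)) = ?x \<and> j (Env (Out n)) = ?x) else 0)"
      by (intro sum.cong) auto
    also have "\<dots> = of_bool (i (Env (In n)) = j (Env (In n))) *
      of_bool (i (Env (Out n)) = ?x \<and> j (Env (Out n)) = ?x)"
      using r[OF n i(2)] by (simp only: sum.delta' finite_lessThan lessThan_iff if_True)
    finally show ?thesis .
  qed
  have val_G: "val (G n) i j = of_bool (i (Env (In n)) = j (Env (In n))) *
      (u n (i (Env (In (Suc n))), i (Sys (In (Suc n)))) (r n (i (Env (In n))), i (Sys (Out n))) *
       cnj (u n (j (Env (In (Suc n))), j (Sys (In (Suc n)))) (r n (i (Env (In n))), j (Sys (Out n)))))"
    if n: "n \<in> {1..<N}" and i: "\<forall>l\<in>labels (G n). i l < d l" and j: "\<forall>l\<in>labels (G n). j l < d l" for n i j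
  proof -
    let ?x = "r n (i (Env (In n)))" and ?l = "Env (Out n)"
    have x: "?x < e (Out n)" using r[OF n, of "i (Env (In n))"] m[OF n] i by (auto simp: labG)
    have "val (G n) i j = (\<Sum>y<d ?l. \<Sum>z<d ?l. val (U n) (i(?l := y)) (j(?l := z)) *
            val (EB n) (i(?l := y)) (j(?l := z)))"
      unfolding G_def using i j unfolding labG by (intro val_link_single) (auto simp: U_def EB_def)
    also have "\<dots> = (\<Sum>y<e (Out n). \<Sum>z<e (Out n). of_bool (y = ?x \<and> z = ?x) * 
      (of_bool (i (Env (In n)) = j (Env (In n))) *
      (u n (i (Env (In (Suc n))), i (Sys (In (Suc n)))) (y, i (Sys (Out n))) *
       cnj (u n (j (Env (In (Suc n))), j (Sys (In (Suc n)))) (z, j (Sys (Out n)))))))"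
    proof (intro sum.cong)
      fix y z assume yz: "y \<in> {..<e (Out n)}" "z \<in> {..<e (Out n)}"
      have "val (U n) (i(?l := y)) (j(?l := z)) =
        u n (i (Env (In (Suc n))), i (Sys (In (Suc n)))) (y, i (Sys (Out n))) *
        cnj (u n (j (Env (In (Suc n))), j (Sys (In (Suc n)))) (z, j (Sys (Out n))))"
        unfolding U_def using i j yz
        by (subst val_choi_unitary_map) (auto simp: labG V_def)
      moreover have "val (EB n) (i(?l := y)) (j(?l := z)) = of_bool (i (Env (In n)) = j (Env (In n))) *
         of_bool (y = ?x \<and> z = ?x)"
        using i j yz by (subst val_EB[OF n]) (auto simp: labG)
      ultimately show "val (U n) (i(?l := y)) (j(?l := z)) * val (EB n) (i(?l := y)) (j(?l := z)) =
        of_bool (y = ?x \<and> z = ?x) * (of_bool (i (Env (In n)) = j (Env (In n))) *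
      (u n (i (Env (In (Suc n))), i (Sys (In (Suc n)))) (y, i (Sys (Out n))) *
       cnj (u n (j (Env (In (Suc n))), j (Sys (In (Suc n)))) (z, j (Sys (Out n))))))"
        by (simp only: mult_ac)
    qed simp_all
    also have "\<dots> = of_bool (i (Env (In n)) = j (Env (In n))) *
      (u n (i (Env (In (Suc n))), i (Sys (In (Suc n)))) (?x, i (Sys (Out n))) *
       cnj (u n (j (Env (In (Suc n))), j (Sys (In (Suc n)))) (?x, j (Sys (Out n)))))"
      using x by (intro sum_of_bool_conj) auto
    finally show ?thesis .
  qed

  \<comment> \<open>Backward recursion over the times\<close>
  have H_step: "H n = link d (G n) (H (Suc n))" if "n < N" for n
    using that by (simp add: H_def big_link_def upt_conv_Cons)
  let ?EN = "Env (In N)"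
  \<comment> \<open>The labels left open by the product over the times from \<open>n\<close> to
    \<open>N - 1\<close>: the environment spaces in between are contracted, and the last one still
    awaits its trace.\<close>
  define LH where "LH n = {Env (In n), ?EN} \<union> Sys ` (Out ` {n..<N} \<union> In ` {Suc n..N})" for n
  have finLH: "finite (LH n)" for n by (simp add: LH_def)
  \<comment> \<open>\<open>CM\<close> traces out the last environment space only after the whole
    product has been formed, so the invariant itself sums over the diagonal at \<open>?EN\<close>.
    The factor \<open>of_bool\<close> records that the measurement at time \<open>n\<close> removes
    coherences.\<close>
  define P where "P n \<longleftrightarrow> labels (H n) = LH n \<and> (\<forall>i j. (\<forall>l\<in>LH n - {?EN}. i l < d l) \<longrightarrow>
     (\<forall>l\<in>LH n - {?EN}. j l < d l) \<longrightarrow> (\<Sum>y<e (In N). val (H n) (i(?EN := y)) (j(?EN := y))) =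
       of_bool (i (Env (In n)) = j (Env (In n))) * f n (i (Env (In n))) (i \<circ> Sys) (j \<circ> Sys))" for n
  have "1 \<le> (1::nat) \<longrightarrow> P 1"
  \<comment> \<open>The induction starts at \<open>N - 1\<close>: at \<open>N\<close> the product is
    empty and equals \<open>id_op d {}\<close>, which lacks the label \<open>?EN\<close>.\<close>
  proof (rule inc_induct[of 1 "N - 1" "\<lambda>n. 1 \<le> n \<longrightarrow> P n"])
    show "1 \<le> N - 1" using N by simp
    show "1 \<le> N - 1 \<longrightarrow> P (N - 1)"
    proof
      obtain n where n: "N = Suc n" "n \<in> {1..<N}" "n < N" using N by (cases N) auto
      have HN: "H (Suc n) = id_op d {}" by (simp add: H_def big_link_def n(1))
      have lH: "labels (H n) = labels (G n)" using n by (simp add: H_step HN)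
      have LHG: "LH n = labels (G n)" by (auto simp: LH_def labG n)
      have "(\<Sum>y<e (In N). val (H n) (i(?EN := y)) (j(?EN := y))) =
         of_bool (i (Env (In n)) = j (Env (In n))) * f n (i (Env (In n))) (i \<circ> Sys) (j \<circ> Sys)"
        if i: "\<forall>l\<in>labels (G n) - {?EN}. i l < d l" and j: "\<forall>l\<in>labels (G n) - {?EN}. j l < d l" for i j
      proof -
        have b: "i (Sys (Out n)) < s (Out n)" "i (Env (In n)) < e (In n)" "i (Sys (In (Suc n))) < s (In (Suc n))"
           "j (Sys (Out n)) < s (Out n)" "j (Env (In n)) < e (In n)" "j (Sys (In (Suc n))) < s (In (Suc n))"
          using bspec[OF i, of "Sys (Out n)"] bspec[OF i, of "Env (In n)"] bspec[OF i, of "Sys (In (Suc n))"]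
            bspec[OF j, of "Sys (Out n)"] bspec[OF j, of "Env (In n)"] bspec[OF j, of "Sys (In (Suc n))"]
          by (simp_all add: labG n(1))
        have "val (H n) (i(?EN := y)) (j(?EN := y)) = val (G n) (i(?EN := y)) (j(?EN := y))"
          if "y < e (In N)" for y
        proof -
          have "val (H n) (i(?EN := y)) (j(?EN := y)) =
             val (G n) (i(?EN := y)) (j(?EN := y)) * val (id_op d {}) (i(?EN := y)) (j(?EN := y))"
            unfolding H_step[OF n(3)] HN
            using b that n(1) by (intro val_link_disjoint) (auto simp: labG)
          then show ?thesis by (simp add: val_id_op)
        qed
        then have "(\<Sum>y<e (In N). val (H n) (i(?EN := y)) (j(?EN := y))) =
          (\<Sum>y<e (In N). of_bool (i (Env (In n)) = j (Env (In n))) *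
             (u n (y, i (Sys (In (Suc n)))) (r n (i (Env (In n))), i (Sys (Out n))) *
              cnj (u n (y, j (Sys (In (Suc n)))) (r n (i (Env (In n))), j (Sys (Out n))))))"
          using b n(1,2) by (intro sum.cong) (auto simp: val_G labG)
        also have "\<dots> = of_bool (i (Env (In n)) = j (Env (In n))) * f n (i (Env (In n))) (i \<circ> Sys) (j \<circ> Sys)"
          using b n(2) by (subst f) (auto simp: fN[unfolded n(1)] sum_distrib_left n(1))
        finally show ?thesis .
      qed
      then have "P n" using lH unfolding P_def LHG by blast
      then show "P (N - 1)" using n by simp
    qed
    fix n assume n: "1 \<le> n" "n < N - 1" and IH: "1 \<le> Suc n \<longrightarrow> P (Suc n)"
    then have n': "n \<in> {1..<N}" "n < N" "Suc n \<noteq> N" "n \<noteq> N" by auto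
    let ?l = "Env (In (Suc n))"
    have labS: "labels (H (Suc n)) = LH (Suc n)" using IH by (simp add: P_def)
    have int: "labels (G n) \<inter> LH (Suc n) = {?l}"
      using n n' by (auto simp: labG LH_def)
    have ivl: "{n..<N} = insert n {Suc n..<N}" "{Suc n..N} = insert (Suc n) {Suc (Suc n)..N}"
      using n by auto
    have un: "labels (G n) \<union> LH (Suc n) = insert ?l (LH n)" "?l \<notin> LH n"
      using n n' by (auto simp: labG LH_def ivl)
    have ENG: "?EN \<notin> labels (G n)" using n' by (simp add: labG)
    have labn: "labels (H n) = LH n"
      using un by (simp add: H_step n' labS int)
    have "(\<Sum>y<e (In N). val (H n) (i(?EN := y)) (j(?EN := y))) =
         of_bool (i (Env (In n)) = j (Env (In n))) * f n (i (Env (In n))) (i \<circ> Sys) (j \<circ> Sys)"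
      if i: "\<forall>l\<in>LH n - {?EN}. i l < d l" and j: "\<forall>l\<in>LH n - {?EN}. j l < d l" for i j
    proof -
      have "(\<Sum>y<e (In N). val (H n) (i(?EN := y)) (j(?EN := y))) =
        (\<Sum>y<e (In N). \<Sum>y'<e (In (Suc n)). \<Sum>z'<e (In (Suc n)).
          val (G n) (i(?l := y')) (j(?l := z')) *
          val (H (Suc n)) (i(?l := y', ?EN := y)) (j(?l := z', ?EN := y)))"
      proof (intro sum.cong refl)
        fix y assume y: "y \<in> {..<e (In N)}"
        have "val (H n) (i(?EN := y)) (j(?EN := y)) = (\<Sum>y'<d ?l. \<Sum>z'<d ?l.
          val (G n) (i(?EN := y, ?l := y')) (j(?EN := y, ?l := z')) *
          val (H (Suc n)) (i(?EN := y, ?l := y')) (j(?EN := y, ?l := z')))"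
          unfolding H_step[OF n'(2)]
        proof (rule val_link_single)
          show "labels (G n) \<inter> labels (H (Suc n)) = {?l}" unfolding labS by (rule int)
          show "finite (labels (G n))" "finite (labels (H (Suc n)))"
            by (simp_all add: labG labS finLH)
          show "\<forall>k\<in>labels (G n) \<union> labels (H (Suc n)) - {?l}. (i(?EN := y)) k < d k"
            "\<forall>k\<in>labels (G n) \<union> labels (H (Suc n)) - {?l}. (j(?EN := y)) k < d k"
            unfolding labS un(1) using i j y by auto
        qed
        also have "\<dots> = (\<Sum>y'<e (In (Suc n)). \<Sum>z'<e (In (Suc n)).
          val (G n) (i(?l := y')) (j(?l := z')) *
          val (H (Suc n)) (i(?l := y', ?EN := y)) (j(?l := z', ?EN := y)))"
          using n' by (intro sum.cong arg_cong2[where f = "(*)"] val_cong) (auto simp: labG)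
        finally show "val (H n) (i(?EN := y)) (j(?EN := y)) = \<dots>" .
      qed
      \<comment> \<open>The first factor does not involve \<open>?EN\<close>, so the sum over
        \<open>y\<close> can be moved inside, where the induction hypothesis evaluates it.\<close>
      also have "\<dots> = (\<Sum>y'<e (In (Suc n)). \<Sum>z'<e (In (Suc n)). \<Sum>y<e (In N).
          val (G n) (i(?l := y')) (j(?l := z')) *
          val (H (Suc n)) (i(?l := y', ?EN := y)) (j(?l := z', ?EN := y)))"
        by (subst sum.swap, rule sum.cong[OF refl], rule sum.swap)
      \<comment> \<open>The condition \<open>y' = z'\<close> comes from the induction hypothesis: it
        is the dephasing by the measurement at time \<open>Suc n\<close>.\<close>
      also have "\<dots> = (\<Sum>y'<e (In (Suc n)). \<Sum>z'<e (In (Suc n)). if y' = z' then 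
          val (G n) (i(?l := y')) (j(?l := z')) * f (Suc n) y' (i \<circ> Sys) (j \<circ> Sys) else 0)"
      proof (intro sum.cong refl)
        fix y' z' assume yz: "y' \<in> {..<e (In (Suc n))}" "z' \<in> {..<e (In (Suc n))}"
        have "(\<Sum>y<e (In N). val (H (Suc n)) (i(?l := y', ?EN := y)) (j(?l := z', ?EN := y))) =
          of_bool (y' = z') * f (Suc n) y' (i \<circ> Sys) (j \<circ> Sys)"
        proof -
          have "\<forall>l\<in>LH (Suc n) - {?EN}. (i(?l := y')) l < d l" "\<forall>l\<in>LH (Suc n) - {?EN}. (j(?l := z')) l < d l"
            using i j yz un(1) by auto
          then show ?thesis using IH unfolding P_def by simp
        qed
        then show "(\<Sum>y<e (In N). val (G n) (i(?l := y')) (j(?l := z')) *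
          val (H (Suc n)) (i(?l := y', ?EN := y)) (j(?l := z', ?EN := y))) = (if y' = z' then 
          val (G n) (i(?l := y')) (j(?l := z')) * f (Suc n) y' (i \<circ> Sys) (j \<circ> Sys) else 0)"
          unfolding sum_distrib_left[symmetric] by simp
      qed
      also have "\<dots> = (\<Sum>y'<e (In (Suc n)).
          val (G n) (i(?l := y')) (j(?l := y')) * f (Suc n) y' (i \<circ> Sys) (j \<circ> Sys))"
        by simp
      also have "\<dots> = (\<Sum>y'<e (In (Suc n)). of_bool (i (Env (In n)) = j (Env (In n))) *
         (u n (y', i (Sys (In (Suc n)))) (r n (i (Env (In n))), i (Sys (Out n))) *
          cnj (u n (y', j (Sys (In (Suc n)))) (r n (i (Env (In n))), j (Sys (Out n)))) *
           f (Suc n) y' (i \<circ> Sys) (j \<circ> Sys)))"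
      proof (intro sum.cong refl)
        fix y' assume y': "y' \<in> {..<e (In (Suc n))}"
        have "\<forall>l\<in>labels (G n). (i(?l := y')) l < d l" "\<forall>l\<in>labels (G n). (j(?l := y')) l < d l"
          using i j y' un(1) int n' ENG by auto
        then show "val (G n) (i(?l := y')) (j(?l := y')) * f (Suc n) y' (i \<circ> Sys) (j \<circ> Sys) =
         of_bool (i (Env (In n)) = j (Env (In n))) *
         (u n (y', i (Sys (In (Suc n)))) (r n (i (Env (In n))), i (Sys (Out n))) *
          cnj (u n (y', j (Sys (In (Suc n)))) (r n (i (Env (In n))), j (Sys (Out n)))) *
           f (Suc n) y' (i \<circ> Sys) (j \<circ> Sys))"
          by (subst val_G[OF n'(1)]) simp_all
      qed
      also have "\<dots> = of_bool (i (Env (In n)) = j (Env (In n))) * f n (i (Env (In n))) (i \<circ> Sys) (j \<circ> Sys)"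
      proof -
        have "Env (In n) \<in> LH n - {?EN}" "Sys (Out n) \<in> LH n - {?EN}" "Sys (In (Suc n)) \<in> LH n - {?EN}"
          using n n' by (auto simp: LH_def)
        from bspec[OF i this(1)] bspec[OF i this(2)] bspec[OF i this(3)]
          bspec[OF j this(1)] bspec[OF j this(2)] bspec[OF j this(3)]
        show ?thesis using n'(1) by (subst f[of n]) (auto simp: sum_distrib_left)
      qed
      finally show ?thesis .
    qed
    then show "1 \<le> n \<longrightarrow> P n" unfolding P_def using labn by blast
  qed
  then have P1: "P 1" by simp

  \<comment> \<open>The trace over the last environment space and the initial state\<close>
  let ?E1 = "Env (In 1)" and ?S1 = "Sys (In 1)"
  let ?T = "link d (id_op d {?EN}) (H 1)"
  have lab1: "labels (H 1) = LH 1" using P1 by (simp add: P_def)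
  have ENLH: "?EN \<in> LH n" for n by (simp add: LH_def)
  have labT: "labels ?T = LH 1 - {?EN}" unfolding labels_simps lab1 using ENLH by blast
  have lab\<rho>: "labels \<rho> = {?E1, ?S1}" using \<rho> unfolding density_def by (metis labels_ops)
  have E1: "?E1 \<noteq> ?EN" using N by simp
  have intT: "labels ?T \<inter> labels \<rho> = {?E1}"
    unfolding labT lab\<rho> using N by (auto simp: LH_def)
  have ivl: "{1..N} = insert 1 {Suc 1..N}" using N by auto
  have unT: "labels ?T \<union> labels \<rho> = insert ?E1 (X N)" "?E1 \<notin> X N"
    unfolding labT lab\<rho> X_def ivl using N by (auto simp: LH_def)
  have val_T: "val ?T i j = of_bool (i ?E1 = j ?E1) * f 1 (i ?E1) (i \<circ> Sys) (j \<circ> Sys)"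
    if i: "\<forall>l\<in>LH 1 - {?EN}. i l < d l" and j: "\<forall>l\<in>LH 1 - {?EN}. j l < d l" for i j
  proof -
    have "val ?T i j = (\<Sum>y<d ?EN. \<Sum>z<d ?EN. val (id_op d {?EN}) (i(?EN := y)) (j(?EN := z)) *
           val (H 1) (i(?EN := y)) (j(?EN := z)))"
    proof (rule val_link_single)
      show "labels (id_op d {?EN}) \<inter> labels (H 1) = {?EN}" unfolding lab1 labels_simps using ENLH by blast
      show "finite (labels (id_op d {?EN}))" "finite (labels (H 1))" unfolding lab1 using finLH by simp_all
      show "\<forall>k\<in>labels (id_op d {?EN}) \<union> labels (H 1) - {?EN}. i k < d k"
        "\<forall>k\<in>labels (id_op d {?EN}) \<union> labels (H 1) - {?EN}. j k < d k"
        unfolding lab1 labels_simps using i j by blast+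
    qed
    also have "\<dots> = (\<Sum>y<e (In N). \<Sum>z<e (In N). if y = z then val (H 1) (i(?EN := y)) (j(?EN := z)) else 0)"
      by (intro sum.cong) (auto simp: val_id_op)
    also have "\<dots> = (\<Sum>y<e (In N). val (H 1) (i(?EN := y)) (j(?EN := y)))"
      by simp
    also have "\<dots> = of_bool (i ?E1 = j ?E1) * f 1 (i ?E1) (i \<circ> Sys) (j \<circ> Sys)"
      using P1 i j unfolding P_def by blast
    finally show ?thesis .
  qed
  have "W = link d ?T \<rho>"
  proof (rule ops_eqI)
    show "W \<in> ops d (X N)" using W by (simp add: d_def)
    have "labels ?T \<union> labels \<rho> - labels ?T \<inter> labels \<rho> = X N"
      unfolding intT unT using unT(2) by auto
    then show "link d ?T \<rho> \<in> ops d (X N)" using link_ops[of d ?T \<rho>] by simp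
    then have labW: "labels (link d ?T \<rho>) = X N" by (rule labels_ops)
    fix i j assume i: "i \<in> multi d (X N)" and j: "j \<in> multi d (X N)"
    have "entry (link d ?T \<rho>) i j = val (link d ?T \<rho>) i j"
      by (rule entry_val[of _ d]) (simp_all only: labW i j)
    also have "\<dots> = (\<Sum>y<d ?E1. \<Sum>z<d ?E1. val ?T (i(?E1 := y)) (j(?E1 := z)) *
       val \<rho> (i(?E1 := y)) (j(?E1 := z)))"
    proof (rule val_link_single[OF intT])
      show "finite (labels ?T)" unfolding labT using finLH by simp
      show "finite (labels \<rho>)" by (simp add: lab\<rho>)
      show "\<forall>k\<in>labels ?T \<union> labels \<rho> - {?E1}. i k < d k" "\<forall>k\<in>labels ?T \<union> labels \<rho> - {?E1}. j k < d k"
        unfolding unT using i j by (auto simp: multi_lt)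
    qed
    also have "\<dots> = (\<Sum>y<e (In 1). \<Sum>z<e (In 1). if y = z then f 1 y (i \<circ> Sys) (j \<circ> Sys) *
       val \<rho> (i(?E1 := y)) (j(?E1 := z)) else 0)"
    proof (intro sum.cong)
      fix y z assume yz: "y \<in> {..<e (In 1)}" "z \<in> {..<e (In 1)}"
      have sub: "LH 1 - {?EN} \<subseteq> insert ?E1 (X N)" using unT(1) unfolding labT by blast
      have "\<forall>l\<in>LH 1 - {?EN}. (i(?E1 := y)) l < d l" "\<forall>l\<in>LH 1 - {?EN}. (j(?E1 := z)) l < d l"
        using i j yz sub by (auto simp: multi_lt)
      then show "val ?T (i(?E1 := y)) (j(?E1 := z)) * val \<rho> (i(?E1 := y)) (j(?E1 := z)) =
         (if y = z then f 1 y (i \<circ> Sys) (j \<circ> Sys) * val \<rho> (i(?E1 := y)) (j(?E1 := z)) else 0)"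
        by (subst val_T) simp_all
    qed simp_all
    also have "\<dots> = (\<Sum>y<e (In 1). f 1 y (i \<circ> Sys) (j \<circ> Sys) * val \<rho> (i(?E1 := y)) (j(?E1 := y)))"
      by simp
    also have "\<dots> = entry W i j"
      using entry_W i j by (simp add: d_def)
    finally show "entry W i j = entry (link d ?T \<rho>) i j" by simp
  qed
  then have WE: "W = link d (link d (id_op d {?EN}) (big_link d (\<lambda>n. link d (U n) (EB n)) [1..<N])) \<rho>"
    by (simp add: H_def flip: G_def)

  \<comment> \<open>Unitarity, preparations and measurements\<close>
  have unit: "unitary d {Env (Out n), Sys (Out n)} {Env (In (n + 1)), Sys (In (n + 1))} (V n)"
    if n: "n \<in> {1..<N}" for n
    unfolding unitary_def
  proof (intro conjI ballI)
    let ?I = "{..<e (In (Suc n))} \<times> {..<s (In (Suc n))}" and ?J = "{..<e (Out n)} \<times> {..<s (Out n)}"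
    let ?a = "{Env (Out n), Sys (Out n)}" and ?b = "{Env (In (n + 1)), Sys (In (n + 1))}"
    have eqI: "k = l" if "k \<in> multi d {p, q}" "l \<in> multi d {p, q}" "k p = l p" "k q = l q" 
      for k l :: "label index" and p q
      using that by (auto simp: multi_def intro: PiE_ext)
    {
      fix k l assume k: "k \<in> multi d ?a" and l: "l \<in> multi d ?a"
      let ?k = "(k (Env (Out n)), k (Sys (Out n)))" and ?l = "(l (Env (Out n)), l (Sys (Out n)))"
      have "(\<Sum>i\<in>multi d ?b. cnj (V n i k) * V n i l) = (\<Sum>p\<in>?I. cnj (u n p ?k) * u n p ?l)"
        using sum_multi_pair[of "Env (In (n + 1))" "Sys (In (n + 1))" "\<lambda>p. cnj (u n p ?k) * u n p ?l" d]
        by (simp add: V_def)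
      also have "\<dots> = of_bool (?k = ?l)"
      proof -
        have "?k \<in> ?J" "?l \<in> ?J" using multi_lt[OF k] multi_lt[OF l] by force+
        then show ?thesis using u[OF n] unfolding orthonormal_on_def by blast
      qed
      also have "(?k = ?l) = (k = l)" using eqI[OF k l] by auto
      finally show "(\<Sum>i\<in>multi d ?b. cnj (V n i k) * V n i l) = of_bool (k = l)" .
    }
    {
      fix k l assume k: "k \<in> multi d ?b" and l: "l \<in> multi d ?b"
      let ?k = "(k (Env (In (Suc n))), k (Sys (In (Suc n))))"
      let ?l = "(l (Env (In (Suc n))), l (Sys (In (Suc n))))"
      have "(\<Sum>i\<in>multi d ?a. V n k i * cnj (V n l i)) = (\<Sum>p\<in>?J. u n ?k p * cnj (u n ?l p))"
        using sum_multi_pair[of "Env (Out n)" "Sys (Out n)" "\<lambda>p. u n ?k p * cnj (u n ?l p)" d]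
        by (simp add: V_def)
      \<comment> \<open>By \<open>dims\<close> the system is square, so orthonormality passes from
        the columns to the rows.\<close>
      also have "\<dots> = of_bool (?k = ?l)"
        using u[OF n] dims[OF n] multi_lt[OF k, of "Env (In (Suc n))"] multi_lt[OF k, of "Sys (In (Suc n))"]
          multi_lt[OF l, of "Env (In (Suc n))"] multi_lt[OF l, of "Sys (In (Suc n))"]
        by (intro orthonormal_complete) (auto simp: card_cartesian_product)
      also have "(?k = ?l) = (k = l)" using eqI[OF k l] by auto
      finally show "(\<Sum>i\<in>multi d ?a. V n k i * cnj (V n l i)) = of_bool (k = l)" .
    }
  qed
  have dens: "density d {Env (Out n)} (\<sigma> n x)" if "n \<in> {1..<N}" "x < m n" for n x
    unfolding \<sigma>_def using m[OF that(1)] that(2) by (intro density_ketbra) simp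
  have povm: "povm d {Env (In n)} (m n) (M n)" if "n \<in> {1..<N}" for n
    unfolding M_def using r[OF that] by (intro povm_readout) auto
  have "(\<forall>p. 0 < e p) \<and> density d {?E1, ?S1} \<rho> \<and> (\<forall>n\<in>{1..<N}.
      unitary d {Env (Out n), Sys (Out n)} {Env (In (n + 1)), Sys (In (n + 1))} (V n) \<and>
      (\<forall>x<m n. density d {Env (Out n)} (\<sigma> n x)) \<and> povm d {Env (In n)} (m n) (M n))"
    using unit dens povm pos \<rho> by (auto simp: d_def)
  then show ?thesis using WE unfolding CM_def Let_def U_def EB_def d_def by blast
qed

section \<open>Kraus operators and mixed memoryless processes\<close>

lemma restrict_singleton: "restrict i {l} = restrict (\<lambda>_. i l) {l}"
  by (auto simp: restrict_def)

lemma val_singleton: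
  assumes "labels A = {l}"
  shows "val A i j = entry A (restrict (\<lambda>_. i l) {l}) (restrict (\<lambda>_. j l) {l})"
  using restrict_singleton[of i l] restrict_singleton[of j l] by (simp add: val_def assms)

text \<open>The Choi matrix of a map between single labels, with rows and columns numbered by pairs
  (input index, output index). In this form it is a matrix over a finite set, to which
  \<open>psd_gram\<close> applies.\<close>

definition choi_entry ::
    "('l \<Rightarrow> nat) \<Rightarrow> 'l \<Rightarrow> 'l \<Rightarrow> ('l lop \<Rightarrow> 'l lop) \<Rightarrow> nat \<times> nat \<Rightarrow> nat \<times> nat \<Rightarrow> complex" where
  "choi_entry d a b K = (\<lambda>(p, t) (q, t').
     entry (K (ketbra d {a} (restrict (\<lambda>_. p) {a}) (restrict (\<lambda>_. q) {a})))
       (restrict (\<lambda>_. t) {b}) (restrict (\<lambda>_. t') {b}))"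

lemma linear_map_ketbra:
  "linear_map d a b K \<Longrightarrow> K (ketbra d a m n) \<in> ops d b"
  by (simp add: linear_map_def ketbra_def)

text \<open>Trace preservation on matrix units says that the partial trace of the Choi operator over
  the output is the identity. This yields the completeness relation of the Kraus operators and, for
  a one-dimensional output, the obstruction to \<open>MM\<close> in the strictness proof.\<close>

lemma cptp_ketbra_trace:
  assumes "cptp d {a} {b} K" "p < d a" "q < d a"
  shows "(\<Sum>t<d b. choi_entry d a b K (p, t) (q, t)) = of_bool (p = q)"
proof -
  let ?k = "ketbra d {a} (restrict (\<lambda>_. p) {a}) (restrict (\<lambda>_. q) {a})"
  have eq: "restrict (\<lambda>_. x) {a} = restrict (\<lambda>_. y) {a} \<longleftrightarrow> x = y" for x y :: nat
    by (auto simp: restrict_def fun_eq_iff)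
  have "labels (K ?k) = {b}"
    using assms(1) linear_map_ketbra by (metis cptp_def labels_ops)
  then have "(\<Sum>t<d b. choi_entry d a b K (p, t) (q, t)) = op_trace d (K ?k)"
    by (simp add: op_trace_def sum_multi_singleton choi_entry_def)
  also have "\<dots> = op_trace d ?k"
    using assms(1) by (simp add: cptp_def trace_preserving_def ketbra_def)
  also have "\<dots> = (\<Sum>y<d a. if y = p then of_bool (p = q) else 0)"
    using assms(2,3) unfolding op_trace_def labels_simps sum_multi_singleton
    by (intro sum.cong) (auto simp: ketbra_def entry_mk_op eq)
  also have "\<dots> = of_bool (p = q)" using assms(2) by simp
  finally show ?thesis .
qed

text \<open>\<open>B k p t\<close> is the matrix entry of the \<open>k\<close>-th Kraus operator in row \<open>t\<close> and column \<open>p\<close>.\<close>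

definition kraus ::
    "('l \<Rightarrow> nat) \<Rightarrow> 'l \<Rightarrow> 'l \<Rightarrow> ('l lop \<Rightarrow> 'l lop) \<Rightarrow> (nat \<Rightarrow> nat \<Rightarrow> nat \<Rightarrow> complex) \<Rightarrow> bool" where
  "kraus d a b K B \<longleftrightarrow>
     (\<forall>p<d a. \<forall>q<d a. \<forall>t<d b. \<forall>t'<d b.
        choi_entry d a b K (p, t) (q, t') = (\<Sum>k<d a * d b. B k p t * cnj (B k q t'))) \<and>
     (\<forall>p<d a. \<forall>q<d a. (\<Sum>k<d a * d b. \<Sum>t<d b. cnj (B k p t) * B k q t) = of_bool (p = q))"

text \<open>Choi's argument: complete positivity is applied to the block matrix of all matrix units,
  an unnormalised maximally entangled state. The image is the Choi matrix, and a Gram factor of it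
  consists of vectorized Kraus operators.\<close>

lemma cptp_kraus:
  assumes K: "cptp d {a} {b} K"
  shows "\<exists>B. kraus d a b K B"
proof -
  define kb where "kb p q = ketbra d {a} (restrict (\<lambda>_. p) {a}) (restrict (\<lambda>_. q) {a})" for p q
  define C where "C = choi_entry d a b K"
  have eq: "restrict (\<lambda>_. x) {l} = restrict (\<lambda>_. y) {l} \<longleftrightarrow> x = y" for x y :: nat and l :: 'a
    by (auto simp: restrict_def fun_eq_iff)
  have kb_ops: "kb p q \<in> ops d {a}" for p q by (simp add: kb_def ketbra_def)
  have "block_psd d {a} (d a) kb"
    unfolding block_psd_def
  proof
    fix v :: "nat \<Rightarrow> 'a index \<Rightarrow> complex"
    \<comment> \<open>Block \<open>p\<close>, \<open>q\<close> is a matrix unit, so only the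
      component of \<open>v p\<close> at \<open>p\<close> enters and the form becomes the squared
      modulus of the sum of all \<open>w p\<close>.\<close>
    define w where "w p = v p (restrict (\<lambda>_. p) {a})" for p
    have "(\<Sum>p<d a. \<Sum>q<d a. \<Sum>i\<in>multi d {a}. \<Sum>j\<in>multi d {a}. cnj (v p i) * entry (kb p q) i j * v q j)
      = (\<Sum>p<d a. \<Sum>q<d a. cnj (w p) * w q)"
    proof (intro sum.cong refl)
      fix p q assume pq: "p \<in> {..<d a}" "q \<in> {..<d a}"
      have "(\<Sum>i\<in>multi d {a}. \<Sum>j\<in>multi d {a}. cnj (v p i) * entry (kb p q) i j * v q j) =
        (\<Sum>y<d a. \<Sum>z<d a. of_bool (y = p \<and> z = q) *
           (cnj (v p (restrict (\<lambda>_. y) {a})) * v q (restrict (\<lambda>_. z) {a})))"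
        unfolding sum_multi_singleton
        by (intro sum.cong refl) (auto simp: kb_def ketbra_def entry_mk_op eq)
      also have "\<dots> = cnj (w p) * w q"
        unfolding w_def using pq by (intro sum_of_bool_conj) auto
      finally show "(\<Sum>i\<in>multi d {a}. \<Sum>j\<in>multi d {a}. cnj (v p i) * entry (kb p q) i j * v q j) = \<dots>" .
    qed
    also have "\<dots> = cnj (\<Sum>p<d a. w p) * (\<Sum>q<d a. w q)"
      by (simp add: sum_product)
    finally show "(\<Sum>p<d a. \<Sum>q<d a. \<Sum>i\<in>multi d {a}. \<Sum>j\<in>multi d {a}.
        cnj (v p i) * entry (kb p q) i j * v q j) \<in> \<real>\<^sub>\<ge>\<^sub>0"
      using cnj_mult_self_nonneg[of "sum w {..<d a}"] by simp
  qed
  then have block: "block_psd d {b} (d a) (\<lambda>p q. K (kb p q))"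
    using K kb_ops unfolding cptp_def completely_positive_def by blast
  let ?X = "{..<d a} \<times> {..<d b}"
  have "\<exists>B. \<forall>x\<in>?X. \<forall>y\<in>?X. C x y = (\<Sum>k\<in>?X. B k x * cnj (B k y))"
  proof (rule psd_gram)
    fix v :: "nat \<times> nat \<Rightarrow> complex"
    have "(\<Sum>x\<in>?X. \<Sum>y\<in>?X. cnj (v x) * C x y * v y) =
      (\<Sum>p<d a. \<Sum>t<d b. \<Sum>q<d a. \<Sum>t'<d b. cnj (v (p, t)) * C (p, t) (q, t') * v (q, t'))"
      by (simp add: sum.cartesian_product')
    also have "\<dots> = (\<Sum>p<d a. \<Sum>q<d a. \<Sum>t<d b. \<Sum>t'<d b. cnj (v (p, t)) * C (p, t) (q, t') * v (q, t'))"
      by (intro sum.cong refl sum.swap)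
    also have "\<dots> = (\<Sum>p<d a. \<Sum>q<d a. \<Sum>i\<in>multi d {b}. \<Sum>j\<in>multi d {b}.
        cnj (v (p, i b)) * entry (K (kb p q)) i j * v (q, j b))"
      by (simp add: sum_multi_singleton C_def choi_entry_def kb_def)
    also have "\<dots> \<in> \<real>\<^sub>\<ge>\<^sub>0"
      using block unfolding block_psd_def by (rule allE[of _ "\<lambda>p i. v (p, i b)"])
    finally show "(\<Sum>x\<in>?X. \<Sum>y\<in>?X. cnj (v x) * C x y * v y) \<in> \<real>\<^sub>\<ge>\<^sub>0" .
  qed simp
  then obtain B0 where B0: "\<And>x y. x \<in> ?X \<Longrightarrow> y \<in> ?X \<Longrightarrow> C x y = (\<Sum>k\<in>?X. B0 k x * cnj (B0 k y))"
    by blast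
  \<comment> \<open>The Gram factor is indexed by pairs. Numbering them makes the Kraus index a
    value that an environment register can hold.\<close>
  obtain h where h: "bij_betw h {..<d a * d b} ?X"
    using ex_bij_betw_nat_finite[of ?X] by (auto simp: card_cartesian_product atLeast0LessThan)
  define B where "B k p t = B0 (h k) (p, t)" for k p t
  have CB: "C (p, t) (q, t') = (\<Sum>k<d a * d b. B k p t * cnj (B k q t'))"
    if "p < d a" "q < d a" "t < d b" "t' < d b" for p q t t'
    unfolding B_def using that by (subst B0) (auto simp: sum.reindex_bij_betw[OF h, symmetric])
  have "(\<Sum>k<d a * d b. \<Sum>t<d b. cnj (B k p t) * B k q t) = of_bool (p = q)" if "p < d a" "q < d a" for p q
  proof -
    \<comment> \<open>The conjugate stands on the first factor here but on the second in
      \<open>CB\<close>, whence the exchanged order \<open>(q, t) (p, t)\<close>.\<close>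
    have "(\<Sum>k<d a * d b. \<Sum>t<d b. cnj (B k p t) * B k q t) = (\<Sum>t<d b. C (q, t) (p, t))"
      using that by (subst sum.swap) (simp add: CB mult.commute)
    also have "\<dots> = of_bool (q = p)"
      using cptp_ketbra_trace[OF K that(2,1)] by (simp add: C_def)
    finally show ?thesis by (simp add: eq_commute)
  qed
  then show ?thesis
    using CB unfolding C_def kraus_def by (intro exI[of _ B]) auto
qed

text \<open>A register value below \<open>m * k\<close> encodes a pair as quotient and remainder;
  this splits sums over the environment into one over mixture labels and one over Kraus
  indices.\<close>

lemma sum_div_mod:
  fixes g :: "nat \<Rightarrow> nat \<Rightarrow> 'b::comm_monoid_add"
  assumes "0 < k"
  shows "(\<Sum>y<m * k. g (y div k) (y mod k)) = (\<Sum>x<m. \<Sum>z<k. g x z)"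
proof -
  have "(\<Sum>y<m * k. g (y div k) (y mod k)) = (\<Sum>p\<in>{..<m} \<times> {..<k}. g (fst p) (snd p))"
  proof (rule sum.reindex_bij_witness[of _ "\<lambda>p. fst p * k + snd p" "\<lambda>y. (y div k, y mod k)"])
    fix p assume "p \<in> {..<m} \<times> {..<k}"
    then obtain x z where p: "p = (x, z)" "x < m" "z < k" by auto
    have "x * k + z < Suc x * k" using p by simp
    also have "\<dots> \<le> m * k" using p by (intro mult_le_mono1) simp
    finally show "fst p * k + snd p \<in> {..<m * k}" by (simp add: p)
    show "((fst p * k + snd p) div k, (fst p * k + snd p) mod k) = p" using p by simp
  qed (use assms in \<open>auto simp: less_mult_imp_div_less\<close>)
  then show ?thesis by (simp add: sum.cartesian_product')
qed

lemma sum_multi_pair':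
  assumes "l \<noteq> l'"
  shows "(\<Sum>w\<in>multi d {l, l'}. g w) =
    (\<Sum>y<d l. \<Sum>z<d l'. g (restrict (\<lambda>k. if k = l then y else z) {l, l'}))"
proof -
  have "w = restrict (\<lambda>k. if k = l then w l else w l') {l, l'}" if "w \<in> multi d {l, l'}" for w
    using that by (auto simp: multi_def PiE_def extensional_def fun_eq_iff)
  then have "(\<Sum>w\<in>multi d {l, l'}. g w) =
     (\<Sum>w\<in>multi d {l, l'}. (\<lambda>p. g (restrict (\<lambda>k. if k = l then fst p else snd p) {l, l'})) (w l, w l'))"
    by (intro sum.cong refl) (simp only: fst_conv snd_conv)
  also have "\<dots> = (\<Sum>p\<in>{..<d l} \<times> {..<d l'}. g (restrict (\<lambda>k. if k = l then fst p else snd p) {l, l'}))"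
    by (rule sum_multi_pair[OF assms])
  finally show ?thesis by (simp add: sum.cartesian_product' cong: if_cong)
qed

text \<open>The operator is the classical-quantum state with blocks \<open>p x\<close> times
  \<open>\<rho> x\<close>, so its quadratic form is a nonnegative combination of those of the
  blocks. The components come from \<open>MM\<close>, where environment labels have the dummy
  dimension 1; this is why they have their own \<open>d'\<close>.\<close>

lemma density_mixture:
  fixes l l' :: 'l
  assumes "l \<noteq> l'" and p: "\<And>x. x < d l \<Longrightarrow> 0 \<le> p x" "(\<Sum>x<d l. p x) = 1"
    and \<rho>: "\<And>x. x < d l \<Longrightarrow> density d' {l'} (\<rho> x)" and d': "d' l' = d l'"
  shows "density d {l, l'} (mk_op d {l, l'} (\<lambda>i j. of_bool (i l = j l) * (of_real (p (i l)) * val (\<rho> (i l)) i j)))"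
    (is "density d ?L ?R")
proof -
  have lab: "labels (\<rho> x) = {l'}" if "x < d l" for x
    using \<rho>[OF that] by (auto simp: density_def dest: labels_ops)
  define R where "R = ?R"
  have labR: "labels R = {l, l'}" by (simp add: R_def)
  let ?pr = "\<lambda>y z. restrict (\<lambda>k. if k = l then y else z) {l, l'}"
  let ?sg = "\<lambda>z. restrict (\<lambda>_. z) {l'}"
  have ent: "entry R (?pr y z) (?pr y' z') = (if y = y' then of_real (p y) * entry (\<rho> y) (?sg z) (?sg z') else 0)"
    if "y < d l" "y' < d l" "z < d l'" "z' < d l'" for y y' z z'
    using that assms(1) by (simp add: R_def entry_mk_op val_singleton lab)
  have "psd d R"
    unfolding psd_def
  proof
    fix v :: "'l index \<Rightarrow> complex"
    have "(\<Sum>i\<in>multi d ?L. \<Sum>j\<in>multi d ?L. cnj (v i) * entry R i j * v j) =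
      (\<Sum>y<d l. \<Sum>z<d l'. \<Sum>y'<d l. if y = y' then
         of_real (p y) * (\<Sum>z'<d l'. cnj (v (?pr y z)) * entry (\<rho> y) (?sg z) (?sg z') * v (?pr y z')) else 0)"
      unfolding sum_multi_pair'[OF assms(1)]
      by (intro sum.cong refl) (auto simp: ent sum_distrib_left mult_ac intro!: sum.cong)
    also have "\<dots> = (\<Sum>y<d l. of_real (p y) *
      (\<Sum>z<d l'. \<Sum>z'<d l'. cnj (v (?pr y z)) * entry (\<rho> y) (?sg z) (?sg z') * v (?pr y z')))"
      by (simp add: sum_distrib_left)
    also have "\<dots> \<in> \<real>\<^sub>\<ge>\<^sub>0"
    proof (rule sum_nonneg_Reals, rule nonneg_Reals_mult_I)
      fix y assume y: "y \<in> {..<d l}"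
      then show "complex_of_real (p y) \<in> \<real>\<^sub>\<ge>\<^sub>0" using p by simp
      have "(\<Sum>i\<in>multi d' {l'}. \<Sum>j\<in>multi d' {l'}. cnj (v (?pr y (i l'))) * entry (\<rho> y) i j * v (?pr y (j l'))) \<in> \<real>\<^sub>\<ge>\<^sub>0"
        using \<rho>[of y] y unfolding density_def psd_def by (simp add: lab)
      then show "(\<Sum>z<d l'. \<Sum>z'<d l'. cnj (v (?pr y z)) * entry (\<rho> y) (?sg z) (?sg z') * v (?pr y z')) \<in> \<real>\<^sub>\<ge>\<^sub>0"
        by (simp add: sum_multi_singleton d' cong: if_cong)
    qed
    finally show "(\<Sum>i\<in>multi d (labels R). \<Sum>j\<in>multi d (labels R). cnj (v i) * entry R i j * v j) \<in> \<real>\<^sub>\<ge>\<^sub>0"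
      by (simp add: labR)
  qed
  moreover have "op_trace d R = 1"
  proof -
    have "op_trace d R = (\<Sum>y<d l. of_real (p y) * (\<Sum>z<d l'. entry (\<rho> y) (?sg z) (?sg z)))"
      unfolding op_trace_def labR sum_multi_pair'[OF assms(1)]
      by (intro sum.cong refl) (simp add: ent sum_distrib_left)
    also have "\<dots> = (\<Sum>y<d l. of_real (p y))"
    proof (intro sum.cong refl)
      fix y assume y: "y \<in> {..<d l}"
      have "op_trace d' (\<rho> y) = 1" using \<rho> y by (simp add: density_def)
      then show "of_real (p y) * (\<Sum>z<d l'. entry (\<rho> y) (?sg z) (?sg z)) = complex_of_real (p y)"
        using y by (simp add: op_trace_def lab sum_multi_singleton d')
    qed
    also have "\<dots> = 1" using p(2) by (metis of_real_1 of_real_sum)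
    finally show ?thesis .
  qed
  ultimately show ?thesis by (simp add: density_def R_def)
qed

section \<open>Entries of mixed memoryless processes\<close>

lemma fold_tensor:
  assumes "1 \<le> n"
  shows "labels (fold (\<lambda>j. tensor d (L j)) [1..<n] \<rho>) = labels \<rho> \<union> (\<Union>k\<in>{1..<n}. labels (L k))"
    and "\<forall>l\<in>labels \<rho> \<union> (\<Union>k\<in>{1..<n}. labels (L k)). i l < d l \<and> j l < d l \<Longrightarrow>
      val (fold (\<lambda>j. tensor d (L j)) [1..<n] \<rho>) i j = (\<Prod>k\<in>{1..<n}. val (L k) i j) * val \<rho> i j"
  using assms
proof (induction n rule: dec_induct)
  case base
  { case 1 then show ?case by simp }
  { case 2 then show ?case by simp }
next
  case (step n)
  have [simp]: "{Suc 0..<Suc n} = insert n {Suc 0..<n}" using step(1) by auto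
  { case 1 then show ?case using step by (auto simp del: upt_Suc simp: upt_Suc_append) }
  { case 2
    then have "val (tensor d (L n) (fold (\<lambda>j. tensor d (L j)) [1..<n] \<rho>)) i j =
        val (L n) i j * val (fold (\<lambda>j. tensor d (L j)) [1..<n] \<rho>) i j"
      using step by (intro val_tensor) auto
    moreover have "val (fold (\<lambda>j. tensor d (L j)) [1..<n] \<rho>) i j = (\<Prod>k\<in>{1..<n}. val (L k) i j) * val \<rho> i j"
      by (rule step.IH(2)) (use 2 in auto)
    ultimately show ?case using step.hyps by (simp add: upt_Suc_append mult_ac del: upt_Suc) }
qed

text \<open>The form in which both halves use membership in \<open>MM\<close>: tensor products
  become products of numbers, and each channel factor sees only the indices at its own output and
  the next input.\<close>

lemma MM_entry:
  assumes N: "1 \<le> N" and W: "W \<in> MM N s"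
  defines "d \<equiv> joint_dim s (\<lambda>_. 1)" and "X \<equiv> Sys ` (In ` {1..N} \<union> Out ` {1..<N})"
  shows "W \<in> ops d X \<and> (\<exists>(m :: nat) (p :: nat \<Rightarrow> real) K \<rho>. (\<forall>x<m. 0 \<le> p x) \<and> (\<Sum>x<m. p x) = 1 \<and>
    (\<forall>x<m. density d {Sys (In 1)} (\<rho> x)) \<and>
    (\<forall>x<m. \<forall>n\<in>{1..<N}. cptp d {Sys (Out n)} {Sys (In (Suc n))} (K x n)) \<and>
    (\<forall>i\<in>multi d X. \<forall>j\<in>multi d X. entry W i j = (\<Sum>x<m. of_real (p x) * ((\<Prod>n\<in>{1..<N}.
       choi_entry d (Sys (Out n)) (Sys (In (Suc n))) (K x n)
         (i (Sys (Out n)), i (Sys (In (Suc n)))) (j (Sys (Out n)), j (Sys (In (Suc n))))) * val (\<rho> x) i j))))"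
proof -
  from W obtain m and p :: "nat \<Rightarrow> real" and K \<rho> where *:
      "(\<forall>x<m. 0 \<le> p x) \<and> (\<Sum>x<m. p x) = 1 \<and>
         (\<forall>x<m. density d {Sys (In 1)} (\<rho> x) \<and>
            (\<forall>j\<in>{1..<N}. cptp d {Sys (Out j)} {Sys (In (j + 1))} (K x j))) \<and>
       W = op_sum d X (\<lambda>x. op_scale d (of_real (p x))
       (fold (\<lambda>j. tensor d (choi d {Sys (Out j)} {Sys (In (j + 1))} (K x j))) [1..<N] (\<rho> x))) {..<m}"
    unfolding MM_def Let_def d_def X_def by blast
  then have p: "\<forall>x<m. 0 \<le> p x" "(\<Sum>x<m. p x) = 1"
    and \<rho>: "\<And>x. x < m \<Longrightarrow> density d {Sys (In 1)} (\<rho> x)"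
    and K: "\<And>x n. x < m \<Longrightarrow> n \<in> {1..<N} \<Longrightarrow> cptp d {Sys (Out n)} {Sys (In (Suc n))} (K x n)"
    and WE: "W = op_sum d X (\<lambda>x. op_scale d (of_real (p x))
       (fold (\<lambda>j. tensor d (choi d {Sys (Out j)} {Sys (In (j + 1))} (K x j))) [1..<N] (\<rho> x))) {..<m}"
    by simp_all
  have lab: "{Sys (In 1)} \<union> (\<Union>k\<in>{1..<N}. {Sys (Out k)} \<union> {Sys (In (k + 1))}) = X"
  proof -
    \<comment> \<open>\<open>In 1\<close> belongs to the initial state, every later input to the
      channel of the preceding time.\<close>
    have *: "{1..N} = insert 1 (Suc ` {1..<N})"
      using N by (auto simp: image_Suc_atLeastLessThan)
    show ?thesis unfolding X_def * Suc_eq_plus1[symmetric] by (auto simp del: image_Suc_atLeastLessThan)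
  qed
  have ent: "entry W i j = (\<Sum>x<m. of_real (p x) * ((\<Prod>n\<in>{1..<N}.
       choi_entry d (Sys (Out n)) (Sys (In (Suc n))) (K x n)
         (i (Sys (Out n)), i (Sys (In (Suc n)))) (j (Sys (Out n)), j (Sys (In (Suc n))))) * val (\<rho> x) i j))"
    if i: "i \<in> multi d X" and j: "j \<in> multi d X" for i j
  proof -
    let ?T = "\<lambda>x. fold (\<lambda>j. tensor d (choi d {Sys (Out j)} {Sys (In (j + 1))} (K x j))) [1..<N] (\<rho> x)"
    have "entry W i j = (\<Sum>x<m. of_real (p x) * ((\<Prod>n\<in>{1..<N}.
         choi_entry d (Sys (Out n)) (Sys (In (Suc n))) (K x n)
           (i (Sys (Out n)), i (Sys (In (Suc n)))) (j (Sys (Out n)), j (Sys (In (Suc n))))) * val (\<rho> x) i j))"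
      unfolding WE op_sum_def entry_mk_op using i j
    proof (simp only: simp_thms if_True, intro sum.cong refl)
      fix x assume x: "x \<in> {..<m}"
      have lr: "labels (\<rho> x) = {Sys (In 1)}" using \<rho>[of x] x unfolding density_def by (metis labels_ops lessThan_iff)
      have labT: "labels (?T x) = X"
        unfolding fold_tensor(1)[OF N] labels_simps lr by (rule lab)
      have "entry (op_scale d (of_real (p x)) (?T x)) i j = of_real (p x) * val (?T x) i j"
        using i j by (simp only: op_scale_def entry_mk_op labT simp_thms if_True entry_val[of _ d])
      also have "val (?T x) i j = (\<Prod>k\<in>{1..<N}. val (choi d {Sys (Out k)} {Sys (In (k + 1))} (K x k)) i j) * val (\<rho> x) i j"
        by (rule fold_tensor(2)[OF N]) (simp only: labels_simps lr lab, use i j in \<open>simp add: multi_lt\<close>)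
      also have "(\<Prod>k\<in>{1..<N}. val (choi d {Sys (Out k)} {Sys (In (k + 1))} (K x k)) i j) =
        (\<Prod>n\<in>{1..<N}. choi_entry d (Sys (Out n)) (Sys (In (Suc n))) (K x n)
           (i (Sys (Out n)), i (Sys (In (Suc n)))) (j (Sys (Out n)), j (Sys (In (Suc n)))))"
      proof (intro prod.cong refl)
        fix n assume n: "n \<in> {1..<N}"
        have Kl: "labels (K x n (ketbra d {Sys (Out n)} a b)) = {Sys (In (n + 1))}" for a b
          using K[of x n] x n linear_map_ketbra unfolding cptp_def
          by (metis labels_ops lessThan_iff Suc_eq_plus1)
        have sub: "Sys (Out n) \<in> X" "Sys (In (Suc n)) \<in> X"
          using n by (auto simp: X_def)
        have "val (choi d {Sys (Out n)} {Sys (In (n + 1))} (K x n)) i j =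
          val (K x n (ketbra d {Sys (Out n)} (restrict i {Sys (Out n)}) (restrict j {Sys (Out n)}))) i j"
          using i j sub by (intro val_choi Kl) (auto simp: multi_lt)
        then show "val (choi d {Sys (Out n)} {Sys (In (n + 1))} (K x n)) i j =
          choi_entry d (Sys (Out n)) (Sys (In (Suc n))) (K x n)
           (i (Sys (Out n)), i (Sys (In (Suc n)))) (j (Sys (Out n)), j (Sys (In (Suc n))))"
          unfolding val_singleton[OF Kl] restrict_singleton[of i] restrict_singleton[of j] choi_entry_def by simp
      qed
      finally show "entry (op_scale d (of_real (p x)) (?T x)) i j = of_real (p x) * ((\<Prod>n\<in>{1..<N}.
         choi_entry d (Sys (Out n)) (Sys (In (Suc n))) (K x n)
           (i (Sys (Out n)), i (Sys (In (Suc n)))) (j (Sys (Out n)), j (Sys (In (Suc n))))) * val (\<rho> x) i j)" .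
    qed
    then show ?thesis .
  qed
  have "W \<in> ops d X" by (simp add: WE op_sum_def)
  then show ?thesis using p \<rho> K ent
    by (intro conjI exI[of _ m] exI[of _ p] exI[of _ K] exI[of _ \<rho>]) auto
qed

section \<open>Inclusion and strictness\<close>

text \<open>Bridges the two settings: \<open>MM\<close> fixes environment dimensions 1 while a
  process in \<open>CM\<close> brings its own \<open>e\<close>, and indices over system labels see
  neither.\<close>

lemma multi_joint_Sys: "multi (joint_dim s e) (Sys ` P) = multi (joint_dim s e') (Sys ` P)"
  by (auto simp: multi_def PiE_def Pi_def)

lemma ops_joint_Sys: "ops (joint_dim s e) (Sys ` P) = ops (joint_dim s e') (Sys ` P)"
  using multi_joint_Sys[of s e P e'] by (simp add: ops_def mk_op_def)

text \<open>
  The environment register at time \<open>n\<close> holds \<open>x * \<kappa> n + k\<close>, where \<open>x\<close> is the label of the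
  mixture and \<open>k\<close> the index of the Kraus operator that was applied last.
\<close>

lemma MM_subset_CM:
  assumes N: "2 \<le> N" and s: "\<And>p. 0 < s p"
  shows "MM N s \<subseteq> CM N s"
proof
  fix W assume W: "W \<in> MM N s"
  define d where "d = joint_dim s (\<lambda>_. 1)"
  define P where "P = In ` {1..N} \<union> Out ` {1..<N}"
  have "1 \<le> N" using N by simp
  from MM_entry[OF this W, folded d_def P_def] obtain m :: nat and p K \<rho> where
    Wops: "W \<in> ops d (Sys ` P)"
    and p: "\<And>x. x < m \<Longrightarrow> 0 \<le> p x" "(\<Sum>x<m. p x) = 1"
    and \<rho>: "\<And>x. x < m \<Longrightarrow> density d {Sys (In 1)} (\<rho> x)"
    and K: "\<And>x n. x < m \<Longrightarrow> n \<in> {1..<N} \<Longrightarrow> cptp d {Sys (Out n)} {Sys (In (Suc n))} (K x n)"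
    and ent: "\<And>i j. i \<in> multi d (Sys ` P) \<Longrightarrow> j \<in> multi d (Sys ` P) \<Longrightarrow>
      entry W i j = (\<Sum>x<m. of_real (p x) * ((\<Prod>n\<in>{1..<N}.
         choi_entry d (Sys (Out n)) (Sys (In (Suc n))) (K x n)
         (i (Sys (Out n)), i (Sys (In (Suc n)))) (j (Sys (Out n)), j (Sys (In (Suc n)))))
          * val (\<rho> x) i j))"
    by blast
  have m: "0 < m" using p(2) by (cases m) auto
  define c where "c x n a b = choi_entry d (Sys (Out n)) (Sys (In (Suc n))) (K x n)
     (a (Out n), a (In (Suc n))) (b (Out n), b (In (Suc n)))" for x n and a b :: "port \<Rightarrow> nat"
  \<comment> \<open>The number of Kraus operators of the channel that ends at \<open>In n\<close>.
    At time 1 no channel has acted, and the register holds the label alone.\<close>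
  define \<kappa> where "\<kappa> n = (if n \<le> 1 then 1 else s (Out (n - 1)) * s (In n))" for n
  have \<kappa>: "0 < \<kappa> n" "1 \<le> n \<Longrightarrow> \<kappa> (Suc n) = s (Out n) * s (In (Suc n))" for n
    using s by (auto simp: \<kappa>_def)
  define e where "e q = (case q of In n \<Rightarrow> m * \<kappa> n | Out n \<Rightarrow> m * (s (In (Suc n)) * s (In (Suc n))))" for q
  have e: "e (In n) = m * \<kappa> n" "e (Out n) = m * (s (In (Suc n)) * s (In (Suc n)))" for n
    by (simp_all add: e_def)
  let ?I = "\<lambda>n. {..<e (In (Suc n))} \<times> {..<s (In (Suc n))}"
  let ?J = "\<lambda>n. {..<e (Out n)} \<times> {..<s (Out n)}"
  have dims: "e (Out n) * s (Out n) = e (In (Suc n)) * s (In (Suc n))" if "n \<in> {1..<N}" for n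
    using that by (simp add: e \<kappa>)
  define B where "B x n = (SOME B. kraus d (Sys (Out n)) (Sys (In (Suc n))) (K x n) B)" for x n
  have kraus: "kraus d (Sys (Out n)) (Sys (In (Suc n))) (K x n) (B x n)" if "x < m" "n \<in> {1..<N}" for x n
    unfolding B_def using cptp_kraus[OF K[OF that]] by (rule someI_ex)
  have [simp]: "d (Sys q) = s q" for q by (simp add: d_def)
  have B: "c x n a b = (\<Sum>k<\<kappa> (Suc n). B x n k (a (Out n)) (a (In (Suc n))) * cnj (B x n k (b (Out n)) (b (In (Suc n)))))"
    if "x < m" "n \<in> {1..<N}" "a (Out n) < s (Out n)" "b (Out n) < s (Out n)"
      "a (In (Suc n)) < s (In (Suc n))" "b (In (Suc n)) < s (In (Suc n))" for x n a b
    using kraus[OF that(1,2)] that unfolding kraus_def c_def by (simp add: \<kappa>)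
  have Bt: "(\<Sum>k<\<kappa> (Suc n). \<Sum>t<s (In (Suc n)). cnj (B x n k y t) * B x n k z t) = of_bool (y = z)"
    if "x < m" "n \<in> {1..<N}" "y < s (Out n)" "z < s (Out n)" for x n y z
    using kraus[OF that(1,2)] that unfolding kraus_def by (simp add: \<kappa>)
  \<comment> \<open>The controlled Stinespring isometry: label \<open>x\<close> with system state
    \<open>\<sigma>\<close> is sent to the sum over \<open>k\<close> and \<open>t\<close> of
    \<open>B x n k \<sigma> t\<close> times register value \<open>x * \<kappa> (Suc n) + k\<close>
    with system state \<open>t\<close>.\<close>
  define v where "v n = (\<lambda>(y', t) (x, \<sigma>). of_bool (y' div \<kappa> (Suc n) = x) * B x n (y' mod \<kappa> (Suc n)) \<sigma> t)" for n
  have "\<exists>u. orthonormal_on (?I n) (?J n) u \<and> (\<forall>i. \<forall>k\<in>{..<m} \<times> {..<s (Out n)}. u i k = v n i k)"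
    if n: "n \<in> {1..<N}" for n
  proof (rule orthonormal_extend)
    have "m * 1 \<le> e (Out n)" unfolding e using s[of "In (Suc n)"] by (intro mult_le_mono) auto
    then show "{..<m} \<times> {..<s (Out n)} \<subseteq> ?J n" by auto
    show "card (?J n) \<le> card (?I n)" using dims[OF n] by (simp add: card_cartesian_product)
    have "(\<Sum>i\<in>?I n. cnj (v n i (x, \<sigma>)) * v n i (x', \<sigma>')) = of_bool ((x, \<sigma>) = (x', \<sigma>'))"
      if "x < m" "\<sigma> < s (Out n)" "x' < m" "\<sigma>' < s (Out n)" for x \<sigma> x' \<sigma>'
    proof -
      let ?k = "\<kappa> (Suc n)"
      \<comment> \<open>Different labels are orthogonal because the register keeps them apart; for
        equal labels the completeness relation \<open>Bt\<close> applies.\<close>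
      have "(\<Sum>i\<in>?I n. cnj (v n i (x, \<sigma>)) * v n i (x', \<sigma>')) =
        (\<Sum>y<m * ?k. (\<lambda>w k. \<Sum>t<s (In (Suc n)). of_bool (w = x) * of_bool (w = x') *
            (cnj (B x n k \<sigma> t) * B x' n k \<sigma>' t)) (y div ?k) (y mod ?k))"
        unfolding sum.cartesian_product' e by (intro sum.cong refl) (auto simp: v_def)
      also have "\<dots> = (\<Sum>w<m. \<Sum>k<?k. \<Sum>t<s (In (Suc n)). of_bool (w = x) * of_bool (w = x') *
            (cnj (B x n k \<sigma> t) * B x' n k \<sigma>' t))"
        by (rule sum_div_mod) (rule \<kappa>)
      also have "\<dots> = (\<Sum>w<m. if w = x then of_bool (x = x') * (\<Sum>k<?k. \<Sum>t<s (In (Suc n)). 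
            cnj (B x n k \<sigma> t) * B x' n k \<sigma>' t) else 0)"
        by (intro sum.cong) (auto simp: sum_distrib_left)
      also have "\<dots> = of_bool ((x, \<sigma>) = (x', \<sigma>'))"
        using that n by (cases "x = x'") (auto simp: Bt)
      finally show ?thesis .
    qed
    then show "orthonormal_on (?I n) ({..<m} \<times> {..<s (Out n)}) (v n)"
      unfolding orthonormal_on_def by auto
  qed simp_all
  then have "\<forall>n\<in>{1..<N}. \<exists>u. orthonormal_on (?I n) (?J n) u \<and> (\<forall>i. \<forall>k\<in>{..<m} \<times> {..<s (Out n)}. u i k = v n i k)"
    by blast
  from bchoice[OF this] obtain u where u: "\<And>n. n \<in> {1..<N} \<Longrightarrow> orthonormal_on (?I n) (?J n) (u n)"
    and uv: "\<And>n i k. n \<in> {1..<N} \<Longrightarrow> k \<in> {..<m} \<times> {..<s (Out n)} \<Longrightarrow> u n i k = v n i k"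
    by blast
  let ?E1 = "Env (In 1)" and ?S1 = "Sys (In 1)" and ?d = "joint_dim s e"
  define R where "R = mk_op ?d {?E1, ?S1}
     (\<lambda>i j. of_bool (i ?E1 = j ?E1) * (of_real (p (i ?E1)) * val (\<rho> (i ?E1)) i j))"
  have e1: "e (In 1) = m" by (simp add: e \<kappa>_def)
  show "W \<in> CM N s"
  \<comment> \<open>Given register value \<open>y\<close>, the remaining times contribute the Choi
    entries of the channels with label \<open>y div \<kappa> n\<close>, whatever Kraus index
    \<open>y\<close> carries.\<close>
  proof (rule CM_readoutI[where e = e and r = "\<lambda>n y. y div \<kappa> n" and m = "\<lambda>_. m" and u = u
        and f = "\<lambda>n y a b. \<Prod>k\<in>{n..<N}. c (y div \<kappa> n) k a b" and \<rho> = R, OF N])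
    show "0 < e q" for q using m \<kappa>(1) s by (cases q) (auto simp: e)
    show "y div \<kappa> n < m" if "y < e (In n)" for n y
      using that by (simp add: e less_mult_imp_div_less)
    show "m \<le> e (Out n)" for n
    proof -
      have "m * 1 \<le> e (Out n)" unfolding e using s[of "In (Suc n)"] by (intro mult_le_mono) auto
      then show ?thesis by simp
    qed
    show "(\<Prod>k\<in>{N..<N}. c (y div \<kappa> N) k a b) = 1" for y a b by simp
    fix n
    assume n: "n \<in> {1..<N}"
    show "e (Out n) * s (Out n) = e (In (Suc n)) * s (In (Suc n))" by (rule dims[OF n])
    show "orthonormal_on (?I n) (?J n) (u n)" by (rule u[OF n])
    fix y a b
    assume y: "y < e (In n)" and a: "a (Out n) < s (Out n)" and b: "b (Out n) < s (Out n)"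
       and a': "a (In (Suc n)) < s (In (Suc n))" and b': "b (In (Suc n)) < s (In (Suc n))"
    let ?k = "\<kappa> (Suc n)" and ?x = "y div \<kappa> n"
    have x: "?x < m" using y by (simp add: e less_mult_imp_div_less)
    let ?B = "\<lambda>k. B ?x n k (a (Out n)) (a (In (Suc n))) * cnj (B ?x n k (b (Out n)) (b (In (Suc n))))"
    \<comment> \<open>The prepared state \<open>?x\<close> is below \<open>m\<close>, so only the
      prescribed columns \<open>v n\<close> of the unitary occur. The later factors depend on
      \<open>y'\<close> through its label alone, so the Kraus index can be summed
      separately.\<close>
    have "(\<Sum>y'<e (In (Suc n)). u n (y', a (In (Suc n))) (?x, a (Out n)) *
         cnj (u n (y', b (In (Suc n))) (?x, b (Out n))) * (\<Prod>k\<in>{Suc n..<N}. c (y' div ?k) k a b)) =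
      (\<Sum>y'<m * ?k. (\<lambda>w k. of_bool (w = ?x) * (?B k * (\<Prod>l\<in>{Suc n..<N}. c w l a b))) (y' div ?k) (y' mod ?k))"
      unfolding e using x a b by (intro sum.cong refl) (auto simp: uv[OF n] v_def)
    also have "\<dots> = (\<Sum>w<m. \<Sum>k<?k. of_bool (w = ?x) * (?B k * (\<Prod>l\<in>{Suc n..<N}. c w l a b)))"
      by (rule sum_div_mod) (rule \<kappa>)
    also have "\<dots> = (\<Sum>w<m. if w = ?x then (\<Sum>k<?k. ?B k) * (\<Prod>l\<in>{Suc n..<N}. c w l a b) else 0)"
      by (intro sum.cong) (auto simp: sum_distrib_right)
    also have "\<dots> = (\<Sum>k<?k. ?B k) * (\<Prod>l\<in>{Suc n..<N}. c ?x l a b)"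
      using x by simp
    also have "(\<Sum>k<?k. ?B k) = c ?x n a b"
      using B[OF x n a b a' b'] by simp
    also have "c ?x n a b * (\<Prod>l\<in>{Suc n..<N}. c ?x l a b) = (\<Prod>k\<in>{n..<N}. c ?x k a b)"
      using n by (simp add: prod.atLeast_Suc_lessThan)
    finally show "(\<Prod>k\<in>{n..<N}. c ?x k a b) = (\<Sum>y'<e (In (Suc n)). u n (y', a (In (Suc n))) (?x, a (Out n)) *
         cnj (u n (y', b (In (Suc n))) (?x, b (Out n))) * (\<Prod>k\<in>{Suc n..<N}. c (y' div ?k) k a b))"
      by simp
  next
    show "density ?d {?E1, ?S1} R"
      unfolding R_def by (rule density_mixture[where d' = d]) (use p \<rho> e1 in \<open>auto simp: d_def\<close>)
    show "W \<in> ops ?d (Sys ` (In ` {1..N} \<union> Out ` {1..<N}))"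
      using Wops unfolding d_def P_def using ops_joint_Sys[of s e _ "\<lambda>_. 1"] by simp
    fix i j assume "i \<in> multi ?d (Sys ` (In ` {1..N} \<union> Out ` {1..<N}))"
      "j \<in> multi ?d (Sys ` (In ` {1..N} \<union> Out ` {1..<N}))"
    then have i: "i \<in> multi d (Sys ` P)" and j: "j \<in> multi d (Sys ` P)"
      unfolding d_def P_def using multi_joint_Sys[of s e _ "\<lambda>_. 1"] by simp_all
    have i1: "i ?S1 < s (In 1)" "j ?S1 < s (In 1)"
      using multi_lt[OF i, of ?S1] multi_lt[OF j, of ?S1] N by (auto simp: P_def d_def)
    have "val R (i(?E1 := x)) (j(?E1 := x)) = of_real (p x) * val (\<rho> x) i j" if "x < m" for x
    proof -
      have lr: "labels (\<rho> x) = {?S1}" using \<rho>[OF that] unfolding density_def by (metis labels_ops)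
      show ?thesis unfolding R_def using i1 that e1
        by (subst val_mk_op) (simp_all add: val_singleton[OF lr])
    qed
    then show "entry W i j = (\<Sum>y<e (In 1). (\<Prod>k\<in>{1..<N}. c (y div \<kappa> 1) k (i \<circ> Sys) (j \<circ> Sys)) *
          val R (i(?E1 := y)) (j(?E1 := y)))"
      unfolding ent[OF i j] e1 by (intro sum.cong refl) (simp add: c_def \<kappa>_def mult_ac)
  qed
qed

section \<open>One-dimensional spaces and the strictness witness\<close>

lemma multi_trivial: "(\<And>l. l \<in> X \<Longrightarrow> d l = 1) \<Longrightarrow> multi d X = {restrict (\<lambda>_. 0) X}"
  by (auto simp: multi_def PiE_def extensional_def fun_eq_iff Pi_def)

lemma density_trivial:
  assumes "\<And>l. l \<in> X \<Longrightarrow> d l = 1"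
  shows "density d X (id_op d X)"
  using multi_trivial[of X d] assms cnj_mult_self_nonneg
  by (simp add: density_def psd_def op_trace_def id_op_def entry_mk_op)

text \<open>
  The witness: the basis state of the system at the output of time 1 is swapped into the
  environment, measured and copied there, and swapped back at the input of time 3.
  All other spaces are trivial.
\<close>

lemma ex_CM_not_MM:
  assumes N: "3 \<le> N"
  shows "\<exists>s :: port \<Rightarrow> nat. (\<forall>p. 0 < s p) \<and> (\<exists>W. W \<in> CM N s \<and> W \<notin> MM N s)"
proof -
  \<comment> \<open>Dimension 2 marks the path of the bit: \<open>Out 1\<close> of the system,
    \<open>In 2\<close> and \<open>Out 2\<close> of the environment, \<open>In 3\<close> of the
    system. Each unitary then preserves the total dimension, 2 at times 1 and 2, and 1
    later.\<close>
  define s :: "port \<Rightarrow> nat" where "s q = (if q = Out 1 \<or> q = In 3 then 2 else 1)" for q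
  define e :: "port \<Rightarrow> nat" where "e q = (if q = In 2 \<or> q = Out 2 then 2 else 1)" for q
  define X where "X = Sys ` (In ` {1..N} \<union> Out ` {1..<N})"
  \<comment> \<open>The Choi operator of the completely dephasing qubit channel from
    \<open>Out 1\<close> to \<open>In 3\<close>: all four indices agree. An identity channel would
    also have coherences, which the measurement at time 2 removes.\<close>
  define W where "W = mk_op (joint_dim s e) X (\<lambda>i j. of_bool (i (Sys (Out 1)) = i (Sys (In 3)) \<and>
     j (Sys (Out 1)) = i (Sys (In 3)) \<and> j (Sys (In 3)) = i (Sys (In 3))))"
  define f :: "nat \<Rightarrow> nat \<Rightarrow> (port \<Rightarrow> nat) \<Rightarrow> (port \<Rightarrow> nat) \<Rightarrow> complex" where
    "f n y a b = (if n \<ge> 3 then 1 else if n = 2 then of_bool (a (In 3) = y \<and> b (In 3) = y)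
       else of_bool (a (Out 1) = a (In 3) \<and> b (Out 1) = a (In 3) \<and> b (In 3) = a (In 3)))" for n y a b
  \<comment> \<open>On either side of a step at most one of the two factors is nontrivial, so an
    index pair is determined by its sum; equating sums is the swap of system and
    environment.\<close>
  define u :: "nat \<Rightarrow> nat \<times> nat \<Rightarrow> nat \<times> nat \<Rightarrow> complex" where
    "u n q q' = of_bool (fst q + snd q = fst q' + snd q')" for n q q'
  have cases: "n = 1 \<or> n = 2 \<or> 3 \<le> n" if "n \<in> {1..<N}" for n using that by auto
  have two: "{..<2} = {0, 1::nat}" by auto
  have "W \<in> CM N s"
  proof (rule CM_readoutI[where e = e and r = "\<lambda>n y. y" and m = "\<lambda>n. e (In n)" and u = u
        and f = f and \<rho> = "id_op (joint_dim s e) {Env (In 1), Sys (In 1)}"])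
    show "2 \<le> N" using N by simp
    show "0 < e q" for q by (simp add: e_def)
    show "e (In n) \<le> e (Out n)" for n by (simp add: e_def)
    show "f N y a b = 1" for y a b using N by (simp add: f_def)
    show "density (joint_dim s e) {Env (In 1), Sys (In 1)} (id_op (joint_dim s e) {Env (In 1), Sys (In 1)})"
      by (rule density_trivial) (auto simp: e_def s_def)
    show "W \<in> ops (joint_dim s e) (Sys ` (In ` {1..N} \<union> Out ` {1..<N}))"
      by (simp add: W_def X_def)
    show "entry W i j = (\<Sum>y<e (In 1). f 1 y (i \<circ> Sys) (j \<circ> Sys) *
         val (id_op (joint_dim s e) {Env (In 1), Sys (In 1)}) (i(Env (In 1) := y)) (j(Env (In 1) := y)))"
      if "i \<in> multi (joint_dim s e) (Sys ` (In ` {1..N} \<union> Out ` {1..<N}))"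
        "j \<in> multi (joint_dim s e) (Sys ` (In ` {1..N} \<union> Out ` {1..<N}))" for i j
    proof -
      have "Sys (In 1) \<in> Sys ` (In ` {1..N} \<union> Out ` {1..<N})" using N by auto
      from multi_lt[OF that(1) this] multi_lt[OF that(2) this]
      have "i (Sys (In 1)) = 0" "j (Sys (In 1)) = 0" by (simp_all add: s_def)
      then have "val (id_op (joint_dim s e) {Env (In 1), Sys (In 1)}) (i(Env (In 1) := 0)) (j(Env (In 1) := 0)) = 1"
        by (subst val_id_op) (auto simp: e_def s_def)
      moreover have "{..<e (In 1)} = {0}" by (auto simp: e_def)
      ultimately show ?thesis
        using that by (simp add: f_def W_def X_def entry_mk_op)
    qed
    fix n assume n: "n \<in> {1..<N}"
    show "e (Out n) * s (Out n) = e (In (Suc n)) * s (In (Suc n))"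
      using cases[OF n] by (auto simp: e_def s_def)
    have "(\<Sum>q\<in>{..<e (In (Suc n))} \<times> {..<s (In (Suc n))}. cnj (u n q (x, y)) * u n q (x', y')) =
       of_bool ((x, y) = (x', y'))"
      if *: "x < e (Out n)" "y < s (Out n)" "x' < e (Out n)" "y' < s (Out n)" for x y x' y'
      using cases[OF n]
    proof (elim disjE)
      assume n: "n = 1"
      have S: "Suc n = 2" "e (In 2) = 2" "s (In 2) = 1" using n by (simp_all add: e_def s_def)
      have r: "x = 0" "x' = 0" using * unfolding n by (simp_all add: e_def)
      have "y = 0 \<or> y = 1" "y' = 0 \<or> y' = 1" using * unfolding n by (auto simp: s_def)
      then show ?thesis unfolding S sum.cartesian_product' two by (elim disjE) (simp_all add: r u_def)
    next
      assume n: "n = 2"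
      have S: "Suc n = 3" "e (In 3) = 1" "s (In 3) = 2" using n by (simp_all add: e_def s_def)
      have r: "y = 0" "y' = 0" using * unfolding n by (simp_all add: s_def)
      have "x = 0 \<or> x = 1" "x' = 0 \<or> x' = 1" using * unfolding n by (auto simp: e_def)
      then show ?thesis unfolding S sum.cartesian_product' two by (elim disjE) (simp_all add: r u_def)
    next
      assume n: "3 \<le> n"
      have S: "e (In (Suc n)) = 1" "s (In (Suc n)) = 1" using n by (simp_all add: e_def s_def)
      have "x = 0" "y = 0" "x' = 0" "y' = 0" using * n by (simp_all add: e_def s_def)
      then show ?thesis unfolding S by (simp add: u_def sum.cartesian_product')
    qed
    then show "orthonormal_on ({..<e (In (Suc n))} \<times> {..<s (In (Suc n))}) ({..<e (Out n)} \<times> {..<s (Out n)}) (u n)"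
      unfolding orthonormal_on_def by blast
    fix y a b
    assume *: "y < e (In n)" "a (Out n) < s (Out n)" "b (Out n) < s (Out n)"
      "a (In (Suc n)) < s (In (Suc n))" "b (In (Suc n)) < s (In (Suc n))"
    from cases[OF n] show "f n y a b = (\<Sum>y'<e (In (Suc n)). u n (y', a (In (Suc n))) (y, a (Out n)) *
         cnj (u n (y', b (In (Suc n))) (y, b (Out n))) * f (Suc n) y' a b)"
    proof (elim disjE)
      assume n: "n = 1"
      have S: "Suc n = 2" "e (In 2) = 2" using n by (simp_all add: e_def)
      have r: "y = 0" "a (In 2) = 0" "b (In 2) = 0" using * unfolding S(1) unfolding n by (simp_all add: e_def s_def)
      have "a (Out 1) = 0 \<or> a (Out 1) = 1" "b (Out 1) = 0 \<or> b (Out 1) = 1"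
        using * unfolding n by (auto simp: s_def)
      then show ?thesis unfolding S unfolding n two by (elim disjE) (auto simp: r f_def u_def)
    next
      assume n: "n = 2"
      have S: "Suc n = 3" "e (In 3) = 1" using n by (simp_all add: e_def)
      have r: "a (Out 2) = 0" "b (Out 2) = 0" using * unfolding n by (simp_all add: s_def)
      show ?thesis unfolding S unfolding n by (simp add: r f_def u_def)
    next
      assume n: "3 \<le> n"
      have "e (In (Suc n)) = 1" using n by (simp add: e_def)
      moreover have "y = 0" "a (Out n) = 0" "b (Out n) = 0" "a (In (Suc n)) = 0" "b (In (Suc n)) = 0"
        using * n by (simp_all add: e_def s_def)
      ultimately show ?thesis using n by (simp add: f_def u_def)
    qed
  qed
  moreover have "W \<notin> MM N s"
  proof
    assume W_MM: "W \<in> MM N s"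
    let ?d = "joint_dim s (\<lambda>_. 1)"
      have "1 \<le> N" using N by simp
    from MM_entry[OF this W_MM, folded X_def] obtain m :: nat and p :: "nat \<Rightarrow> real" and K \<rho> where
      K: "\<And>x n. x < m \<Longrightarrow> n \<in> {1..<N} \<Longrightarrow> cptp ?d {Sys (Out n)} {Sys (In (Suc n))} (K x n)"
      and \<rho>: "\<And>x. x < m \<Longrightarrow> density ?d {Sys (In 1)} (\<rho> x)"
      and ent: "\<And>i j. i \<in> multi ?d X \<Longrightarrow> j \<in> multi ?d X \<Longrightarrow>
      entry W i j = (\<Sum>x<m. of_real (p x) * ((\<Prod>n\<in>{1..<N}.
         choi_entry ?d (Sys (Out n)) (Sys (In (Suc n))) (K x n)
         (i (Sys (Out n)), i (Sys (In (Suc n)))) (j (Sys (Out n)), j (Sys (In (Suc n)))))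
          * val (\<rho> x) i j))"
      by blast
    \<comment> \<open>The diagonal entry at \<open>i b\<close> is the weight of the value 0 at
      \<open>In 3\<close> when basis state \<open>b\<close> enters at \<open>Out 1\<close>. For
      \<open>W\<close> it is 1 or 0 according to \<open>b\<close>, while in a mixture of products
      only the factor at time 1 can see \<open>b\<close>.\<close>
    define i where "i b = restrict (\<lambda>l. if l = Sys (Out 1) then b else 0) X" for b :: nat
    have mem: "Sys (Out 1) \<in> X" "Sys (In 3) \<in> X" "Sys (In 2) \<in> X" "Sys (In 1) \<in> X"
      using N by (auto simp: X_def)
    have i: "i b \<in> multi (joint_dim s e') X" if "b < 2" for b e'
      using that by (auto simp: i_def s_def X_def)
    have i0: "i 0 \<in> multi ?d X" and i1: "i 1 \<in> multi ?d X" by (rule i, simp)+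
    have "entry W (i 0) (i 0) = entry W (i 1) (i 1)"
      unfolding ent[OF i0 i0] ent[OF i1 i1]
    proof (intro sum.cong refl arg_cong2[where f = "(*)"] prod.cong)
      fix x assume x: "x \<in> {..<m}"
      have lr: "labels (\<rho> x) = {Sys (In 1)}"
        using \<rho>[of x] x unfolding density_def by (metis labels_ops lessThan_iff)
      show "val (\<rho> x) (i 0) (i 0) = val (\<rho> x) (i 1) (i 1)"
        unfolding val_singleton[OF lr] using mem by (simp add: i_def)
      fix n assume n: "n \<in> {1..<N}"
      let ?c = "\<lambda>b. choi_entry ?d (Sys (Out n)) (Sys (In (Suc n))) (K x n)
         (i b (Sys (Out n)), i b (Sys (In (Suc n)))) (i b (Sys (Out n)), i b (Sys (In (Suc n))))"
      show "?c 0 = ?c 1"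
      proof (cases "n = 1")
        case False
        have "i 0 (Sys (Out n)) = i 1 (Sys (Out n))" "i 0 (Sys (In (Suc n))) = i 1 (Sys (In (Suc n)))"
          using False by (auto simp: i_def)
        then show ?thesis by simp
      next
        case True
        \<comment> \<open>\<open>In 2\<close> is one-dimensional, so the trace over it consists of
          this single entry, which trace preservation fixes at 1.\<close>
        have "?c b = 1" if b: "b < 2" for b
        proof -
          have "cptp ?d {Sys (Out 1)} {Sys (In 2)} (K x 1)" using K[of x 1] x N by (simp add: numeral_2_eq_2)
          from cptp_ketbra_trace[OF this, of b b] b
          show ?thesis using mem True by (simp add: s_def i_def numeral_2_eq_2)
        qed
        from this[of 0] this[of 1] show ?thesis by simp
      qed
    qed
    moreover have "entry W (i 0) (i 0) = 1" "entry W (i 1) (i 1) = 0"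
      using i[of 0] i[of 1] mem by (simp_all add: W_def entry_mk_op) (simp_all add: i_def)
    ultimately show False by simp
  qed
  moreover have "\<forall>q. 0 < s q" by (simp add: s_def)
  ultimately show ?thesis by blast
qed

theorem lemma1:
  fixes N :: nat
  assumes "N \<ge> 3"
  shows "(\<forall>s :: port \<Rightarrow> nat. (\<forall>p. 0 < s p) \<longrightarrow> MM N s \<subseteq> CM N s) \<and>
    (\<exists>s :: port \<Rightarrow> nat. (\<forall>p. 0 < s p) \<and> (\<exists>W. W \<in> CM N s \<and> W \<notin> MM N s))"
  using MM_subset_CM[of N] ex_CM_not_MM[OF assms] assms by simp

end
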